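(* Given a number $0 < f < 1$ and an integer $\tilde{n} \geq 2$ known to all devices, there is a randomized algorithm in the $\mathsf{No}\text{-}\mathsf{CD}$ model, run on an unknown number $n$ of anonymous devices, such that: (i) the expected energy cost of each device is $O(\tilde{n}^{-1}\log f^{-1})$; (ii) the worst-case energy cost of each device is $O(1 + \tilde{n}^{-1}\log f^{-1})$; (iii) the time complexity is $O(\log f^{-1})$, a fixed number independent of the random bits used; (iv) at the end at most one device identifies itself as a leader, and if $\tilde{n}/2 < n \leq \tilde{n}$ then the probability that no leader is elected is at most $f$.
   Context: Model: devices are connected to a multiple-access channel; communication is in synchronous rounds with a common time zero; in each round a device transmits, listens, or is idle. In the $\mathsf{No}\text{-}\mathsf{CD}$ model, transmitters get no feedback, and a listener receives the message if exactly one device transmits and silence otherwise. Devices are anonymous, run the same algorithm and have private random bits. Energy cost of a device is its number of non-idle (transmitting or listening) rounds. It is not required that all devices learn whether a leader was elected. Constants in $O(\cdot)$ are absolute.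
   Formalization: In (i) and (iii), log f^{-1} is read as max(1, log_2 f^{-1}); with absolute constants the literal bounds fail as f tends to 1 (for n = ñ = 2 there would be no round, so no leader could be elected). For f ≤ 1/2 the bounds are literal. *)

theory Defs
  imports "HOL-Probability.Probability"
begin

datatype 'm action = Idle | Listen | is_Transmit: Transmit (msg: 'm)

text \<open>
  A device is a deterministic function of its private infinite tape of random bits and of the
  feedback it has received so far, one entry per past round: \<open>Some m\<close> if it heard the message
  \<open>m\<close>, and \<open>None\<close> otherwise. The length of the feedback list is the current time, and the
  device can recompute its own past actions. All devices run the same algorithm, which sees
  neither the index of the device nor the number of devices.
\<close>

type_synonym tape = "nat \<Rightarrow> bool"

record algorithm =
  rounds :: nat
  act :: "tape \<Rightarrow> nat option list \<Rightarrow> nat action"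
  claims_leader :: "tape \<Rightarrow> nat option list \<Rightarrow> bool"

definition tape_space :: "tape measure" where
  "tape_space = (\<Pi>\<^sub>M k\<in>UNIV. measure_pmf (bernoulli_pmf (1/2)))"

definition tapes_space :: "nat \<Rightarrow> (nat \<Rightarrow> tape) measure" where
  "tapes_space n = (\<Pi>\<^sub>M i\<in>{..<n}. tape_space)"

definition randomized_algorithm :: "algorithm \<Rightarrow> bool" where
  "randomized_algorithm A \<longleftrightarrow>
     (\<forall>h. (\<lambda>b. act A b h) \<in> measurable tape_space (count_space UNIV)) \<and>
     (\<forall>h. (\<lambda>b. claims_leader A b h) \<in> measurable tape_space (count_space UNIV))"

text \<open>
  The No-CD channel: a listener gets the message if exactly one device transmits, and cannot
  distinguish a collision from silence; transmitters and idle devices get no feedback.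
\<close>

definition no_cd_feedback :: "nat \<Rightarrow> (nat \<Rightarrow> 'm action) \<Rightarrow> nat \<Rightarrow> 'm option" where
  "no_cd_feedback n a i =
     (if a i = Listen \<and> (\<exists>!j. j < n \<and> is_Transmit (a j))
      then Some (msg (a (THE j. j < n \<and> is_Transmit (a j))))
      else None)"

primrec history :: "algorithm \<Rightarrow> nat \<Rightarrow> (nat \<Rightarrow> tape) \<Rightarrow> nat \<Rightarrow> nat \<Rightarrow> nat option list" where
  "history A n \<omega> 0 = (\<lambda>i. [])"
| "history A n \<omega> (Suc t) =
     (\<lambda>i. history A n \<omega> t i @
          [no_cd_feedback n (\<lambda>j. act A (\<omega> j) (history A n \<omega> t j)) i])"

definition energy :: "algorithm \<Rightarrow> nat \<Rightarrow> (nat \<Rightarrow> tape) \<Rightarrow> nat \<Rightarrow> nat" where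
  "energy A n \<omega> i = card {t. t < rounds A \<and> act A (\<omega> i) (history A n \<omega> t i) \<noteq> Idle}"

definition leaders :: "algorithm \<Rightarrow> nat \<Rightarrow> (nat \<Rightarrow> tape) \<Rightarrow> nat set" where
  "leaders A n \<omega> = {i. i < n \<and> claims_leader A (\<omega> i) (history A n \<omega> (rounds A) i)}"

text \<open>
  The factor \<open>log f\<inverse>\<close> inside an \<open>O\<close>, with the usual convention that it is at least 1. For
  \<open>f \<le> 1/2\<close> it is literally the binary logarithm. Without the convention no absolute constant
  can work when \<open>f\<close> tends to 1, since then \<open>log f\<inverse>\<close> tends to 0 and not even one round is
  available.
\<close>

definition log_inv :: "real \<Rightarrow> real" where
  "log_inv f = max 1 (log 2 (1 / f))"

end

theory Submission
  imports Defs
begin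

text \<open>
  Time is divided into slots. In every slot a device is, independently of everything else, a
  sender or a replier with probability about \<open>1 / (2 N)\<close> each, up to a cap on the number of slots
  in which it takes part. A chain of devices passes a token on from slot to slot. The token
  carries the first slot \<open>F\<close> for which no holder is appointed yet. A sender that learns that it is
  the only one of its slot joins the chain and takes over the slots \<open>F, \<dots>, F + c - 1\<close>, so joining
  costs it only constant energy but lengthens the life of the chain by \<open>c\<close> slots. If the token has
  been lost, nobody transmits at the start of a slot, and a new chain may be started by one sender
  and one replier; hence there is never more than one token. The leader is the device appointed
  for the slot after the last one. It exists as soon as \<open>c\<close> times the number of slots with exactly
  one sender and exactly one replier exceeds the number of slots: when the chain dies early, only
  time is lost. That number of slots is concentrated exponentially, and so is the number of
  participations suppressed by the cap.
\<close>

subsection \<open>The token chain\<close>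

text \<open>A transmitter gets no feedback, so a lone sender must learn of its success from a
  listener. A holder that is not itself sending can be this listener; otherwise somebody has to
  listen by chance, which is what repliers are for. With such a holder one sender suffices, yet the
  analysis counts only slots with one sender and one replier: this depends on the roles of the slot
  alone and not on the fate of the token, so these slots are independent and exponential moments
  factorise. The cap turns expected energy into worst-case energy, and each participation that it
  suppresses spoils at most its own slot. With \<open>32768 * k\<close> slots, each a pairing with
  probability at least \<open>1/512\<close>, the mean number of pairings is at least
  \<open>64 * k\<close>. Except with probability at most \<open>exp (- k)\<close>, more than
  \<open>16 * k\<close> occur and fewer than \<open>8 * k\<close> participations are suppressed. The
  more than \<open>8 * k\<close> pairings that survive, worth \<open>c = 4096\<close> slots each,
  outlast all \<open>32768 * k\<close> slots.\<close>

datatype role = Absent | Sender | Replier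

instance role :: countable by countable_datatype

text \<open>
  Slot \<open>t\<close> consists of the rounds \<open>4 t, \<dots>, 4 t + 3\<close>. Below, \<open>r\<close> gives the roles and \<open>g\<close> the feedback
  of one device; its state is the set of slots to which it is appointed together with its latest
  value of \<open>F\<close>, which is reliable only while it holds the token. In the first round the holder
  announces itself to the repliers, unless it is itself a sender. In the second round the senders
  transmit, and the holder listens; after silence in the first round the repliers listen instead.
  In the third round those who heard a sender answer with the first slot of the appointment, so a
  sender that hears the answer knows that it was alone. A holder that is a sender thus relies on
  the repliers to extend its own appointment. In the last round the holder tells \<open>F\<close> to its
  successor.
\<close>

definition admit :: "nat \<Rightarrow> (nat \<Rightarrow> role) \<Rightarrow> (nat \<Rightarrow> nat option) \<Rightarrow> nat \<Rightarrow> nat set \<times> nat \<Rightarrow> nat set \<times> nat"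
  where
  "admit c r g t s =
     (if r t = Sender then
        (case g (Suc (Suc (4 * t))) of None \<Rightarrow> s
         | Some m \<Rightarrow> (let a = (if t \<in> fst s then snd s else m) in (fst s \<union> {a..<a + c}, a + c)))
      else if t \<in> fst s \<and> g (Suc (4 * t)) \<noteq> None then (fst s, snd s + c) else s)"

primrec duty :: "nat \<Rightarrow> (nat \<Rightarrow> role) \<Rightarrow> (nat \<Rightarrow> nat option) \<Rightarrow> nat \<Rightarrow> nat set \<times> nat" where
  "duty c r g 0 = ({}, 0)"
| "duty c r g (Suc t) =
     (fst (admit c r g t (duty c r g t)),
      case g (4 * t + 3) of None \<Rightarrow> snd (admit c r g t (duty c r g t)) | Some m \<Rightarrow> m)"

definition slot_action ::
  "nat \<Rightarrow> (nat \<Rightarrow> role) \<Rightarrow> (nat \<Rightarrow> nat option) \<Rightarrow> nat \<Rightarrow> nat \<Rightarrow> nat action" where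
  "slot_action c r g t k =
     (let s = duty c r g t in
      if k = 0 then
        (if t \<in> fst s \<and> r t \<noteq> Sender then Transmit 0 else if r t = Replier then Listen else Idle)
      else if k = 1 then
        (if r t = Sender then Transmit 0
         else if t \<in> fst s \<or> r t = Replier \<and> g (4 * t) = None then Listen else Idle)
      else if k = 2 then
        (if r t = Sender then Listen
         else if g (Suc (4 * t)) \<noteq> None then Transmit (if t \<in> fst s then snd s else Suc t) else Idle)
      else
        (if t \<in> fst s then Transmit (snd (admit c r g t s))
         else if Suc t \<in> fst (admit c r g t s) then Listen else Idle))"

definition round_action :: "nat \<Rightarrow> (nat \<Rightarrow> role) \<Rightarrow> (nat \<Rightarrow> nat option) \<Rightarrow> nat \<Rightarrow> nat action" where
  "round_action c r g u = slot_action c r g (u div 4) (u mod 4)"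

lemma round_action_slot: "k < 4 \<Longrightarrow> round_action c r g (4 * t + k) = slot_action c r g t k"
  by (simp add: round_action_def)

section \<open>Channel feedback and causality of the protocol\<close>

lemma no_cd_feedback_SomeD:
  assumes "no_cd_feedback n a i = Some m"
  shows "a i = Listen" "\<exists>j<n. a j = Transmit m \<and> (\<forall>k<n. is_Transmit (a k) \<longrightarrow> k = j)"
proof -
  show "a i = Listen" using assms by (auto simp: no_cd_feedback_def split: if_splits)
  have ex: "\<exists>!j. j < n \<and> is_Transmit (a j)"
    and m: "m = msg (a (THE j. j < n \<and> is_Transmit (a j)))"
    using assms by (auto simp: no_cd_feedback_def split: if_splits)
  from ex obtain j where j: "j < n" "is_Transmit (a j)"
    and u: "\<And>k. k < n \<Longrightarrow> is_Transmit (a k) \<Longrightarrow> k = j" by blast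
  have "(THE j. j < n \<and> is_Transmit (a j)) = j"
    using conjI[OF j] by (rule the_equality) (use u in blast)
  with m j have "a j = Transmit m" by simp
  with j(1) u show "\<exists>j<n. a j = Transmit m \<and> (\<forall>k<n. is_Transmit (a k) \<longrightarrow> k = j)" by blast
qed

lemma no_cd_feedback_SomeI:
  assumes "a i = Listen" "j < n" "a j = Transmit m"
    and u: "\<And>k. k < n \<Longrightarrow> is_Transmit (a k) \<Longrightarrow> k = j"
  shows "no_cd_feedback n a i = Some m"
proof -
  have j: "j < n \<and> is_Transmit (a j)" using assms(2,3) by simp
  have "(THE j. j < n \<and> is_Transmit (a j)) = j"
    using j by (rule the_equality) (use u in blast)
  moreover have "\<exists>!j. j < n \<and> is_Transmit (a j)"
    using j by (rule ex1I) (use u in blast)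
  ultimately show ?thesis
    using assms(1,3) by (simp add: no_cd_feedback_def)
qed

lemma duty_cong:
  assumes "\<And>u. u < t \<Longrightarrow> r u = r' u" "\<And>u. u < 4 * t \<Longrightarrow> g u = g' u"
  shows "duty c r g t = duty c r' g' t"
  using assms
proof (induction t)
  case (Suc t)
  have "duty c r g t = duty c r' g' t" by (rule Suc.IH) (use Suc.prems in auto)
  moreover have "r t = r' t" "g (Suc (4 * t)) = g' (Suc (4 * t))" "g (Suc (Suc (4 * t))) = g' (Suc (Suc (4 * t)))"
    "g (4 * t + 3) = g' (4 * t + 3)"
    using Suc.prems by auto
  moreover from this have "admit c r g t s = admit c r' g' t s" for s by (simp add: admit_def)
  ultimately show ?case by (simp split: option.split)
qed simp

lemma slot_action_cong:
  assumes d: "duty c r g t = duty c r' g' t" and rt: "r t = r' t" and k: "k < 4"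
    and g: "\<And>v. v < 4 * t + k \<Longrightarrow> g v = g' v"
  shows "slot_action c r g t k = slot_action c r' g' t k"
proof -
  consider "k = 0" | "k = 1" | "k = 2" | "k = 3" using k by linarith
  then show ?thesis
  proof cases
    case 1
    then show ?thesis by (simp add: slot_action_def Let_def d rt)
  next
    case 2
    with g have "g (4 * t) = g' (4 * t)" by simp
    with 2 show ?thesis by (simp add: slot_action_def Let_def d rt)
  next
    case 3
    with g have "g (Suc (4 * t)) = g' (Suc (4 * t))" by simp
    with 3 show ?thesis by (simp add: slot_action_def Let_def d rt)
  next
    case 4
    have "g (Suc (4 * t)) = g' (Suc (4 * t))" "g (Suc (Suc (4 * t))) = g' (Suc (Suc (4 * t)))"
      by (rule g, simp add: 4)+
    then have "admit c r g t s = admit c r' g' t s" for s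
      unfolding admit_def rt by (simp only:)
    with 4 show ?thesis unfolding slot_action_def Let_def d rt by simp
  qed
qed

text \<open>Causality serves two purposes: a feedback list may be exchanged for an infinite feedback
  sequence that agrees with it on the past, and for a fixed list the action depends on finitely many
  random bits, hence is measurable.\<close>

lemma round_action_cong:
  assumes r: "\<And>v. v \<le> u \<Longrightarrow> r v = r' v" and g: "\<And>v. v < u \<Longrightarrow> g v = g' v"
  shows "round_action c r g u = round_action c r' g' u"
  unfolding round_action_def
proof (rule slot_action_cong)
  show "duty c r g (u div 4) = duty c r' g' (u div 4)"
  proof (rule duty_cong)
    fix v assume "v < u div 4"
    then have "v \<le> u" by linarith
    then show "r v = r' v" by (rule r)
  next
    fix v assume "v < 4 * (u div 4)"
    then have "v < u" by linarith
    then show "g v = g' v" by (rule g)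
  qed
  show "r (u div 4) = r' (u div 4)" by (rule r) simp
  show "u mod 4 < 4" by simp
  fix v assume "v < 4 * (u div 4) + u mod 4"
  then have "v < u" by simp
  then show "g v = g' v" by (rule g)
qed

section \<open>The invariant of a deterministic run\<close>

definition pairing :: "nat \<Rightarrow> (nat \<Rightarrow> role) \<Rightarrow> bool" where
  "pairing n \<rho> \<longleftrightarrow> (\<exists>!i. i < n \<and> \<rho> i = Sender) \<and> (\<exists>!i. i < n \<and> \<rho> i = Replier)"

lemma pairing_cong:
  assumes "\<And>i. i < n \<Longrightarrow> \<rho> i = \<rho>' i"
  shows "pairing n \<rho> = pairing n \<rho>'"
proof -
  have "(\<lambda>i. i < n \<and> \<rho> i = x) = (\<lambda>i. i < n \<and> \<rho>' i = x)" for x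
    using assms by auto
  then show ?thesis unfolding pairing_def by presburger
qed

text \<open>A run is a fixed point: the feedback sequences \<open>g\<close>, taken without a
  horizon, are those that the channel produces from the actions chosen under \<open>g\<close>. The
  roles are arbitrary, so all consequences hold for every outcome of the random bits.\<close>

locale chain =
  fixes n c :: nat and r :: "nat \<Rightarrow> nat \<Rightarrow> role" and g :: "nat \<Rightarrow> nat \<Rightarrow> nat option"
  assumes feedback: "\<And>i u. i < n \<Longrightarrow> g i u = no_cd_feedback n (\<lambda>j. round_action c (r j) (g j) u) i"
begin

abbreviation "move k i t \<equiv> slot_action c (r i) (g i) t k"
abbreviation "state i t \<equiv> duty c (r i) (g i) t"
abbreviation "joined i t \<equiv> admit c (r i) (g i) t (state i t)"

lemma feedback_slot:
  assumes "i < n"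
  shows "g i (4 * t) = no_cd_feedback n (\<lambda>j. move 0 j t) i"
    "g i (Suc (4 * t)) = no_cd_feedback n (\<lambda>j. move 1 j t) i"
    "g i (Suc (Suc (4 * t))) = no_cd_feedback n (\<lambda>j. move 2 j t) i"
    "g i (4 * t + 3) = no_cd_feedback n (\<lambda>j. move 3 j t) i"
proof -
  have "g i (4 * t + k) = no_cd_feedback n (\<lambda>j. move k j t) i" if "k < 4" for k
    using feedback[OF assms, of "4 * t + k"] by (simp only: round_action_slot[OF that])
  note * = this
  have eqs: "4 * t + 0 = 4 * t" "4 * t + 1 = Suc (4 * t)" "4 * t + 2 = Suc (Suc (4 * t))" by simp_all
  show "g i (4 * t) = no_cd_feedback n (\<lambda>j. move 0 j t) i"
    by (rule *[of 0, unfolded eqs]) simp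
  show "g i (Suc (4 * t)) = no_cd_feedback n (\<lambda>j. move 1 j t) i"
    by (rule *[of 1, unfolded eqs]) simp
  show "g i (Suc (Suc (4 * t))) = no_cd_feedback n (\<lambda>j. move 2 j t) i"
    by (rule *[of 2, unfolded eqs]) simp
  show "g i (4 * t + 3) = no_cd_feedback n (\<lambda>j. move 3 j t) i"
    by (rule *) simp
qed

abbreviation "good t \<equiv> pairing n (\<lambda>i. r i t)"

text \<open>\<open>f\<close> is the value of \<open>F\<close> that the token carries. The case
  \<open>f \<le> t\<close> encodes a lost token; then \<open>f\<close> belongs to no device and is
  only an account of past progress.\<close>

definition covered :: "nat \<Rightarrow> nat \<Rightarrow> bool" where
  "covered t f \<longleftrightarrow>
     (\<forall>u\<ge>t. \<forall>i<n. \<forall>j<n. u \<in> fst (state i t) \<and> u \<in> fst (state j t) \<longrightarrow> i = j) \<and>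
     (\<forall>u\<ge>t. (\<exists>i<n. u \<in> fst (state i t)) \<longleftrightarrow> u < f) \<and>
     (\<forall>i<n. t \<in> fst (state i t) \<longrightarrow> snd (state i t) = f)"

lemma admit_other:
  assumes "r i t \<noteq> Sender" "t \<notin> fst (state i t)"
  shows "joined i t = state i t"
  using assms by (simp add: admit_def)

definition "extends t a q \<longleftrightarrow>
    joined q t = (fst (state q t) \<union> {a..<a + c}, a + c) \<and>
    (\<forall>i<n. i \<noteq> q \<longrightarrow> fst (joined i t) = fst (state i t) \<and>
       (t \<in> fst (state i t) \<longrightarrow> snd (joined i t) = a + c))"

lemma admit_with_holder:
  assumes cov: "covered t f" and p: "p < n" "t \<in> fst (state p t)" "r p t \<noteq> Sender"
  shows "(\<not> good t \<and> (\<forall>i<n. joined i t = state i t)) \<or> (\<exists>q<n. extends t f q)"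
proof -
  have pu: "i = p" if "i < n" "t \<in> fst (state i t)" for i
    using cov p that unfolding covered_def by blast
  have pf: "snd (state p t) = f"
    using cov p unfolding covered_def by blast
  have np: "t \<notin> fst (state i t)" if "i < n" "i \<noteq> p" for i
    using pu that by blast
  have t0: "is_Transmit (move 0 i t) \<Longrightarrow> t \<in> fst (state i t)" for i
    by (auto simp: slot_action_def Let_def split: if_splits)
  have x0: "g i (4 * t) \<noteq> None" if i: "i < n" "i \<noteq> p" "r i t = Replier" for i
  proof -
    have "move 0 i t = Listen" using i np[OF i(1,2)] by (simp add: slot_action_def)
    moreover have "move 0 p t = Transmit 0" using p by (simp add: slot_action_def)
    moreover have "k = p" if "k < n" "is_Transmit (move 0 k t)" for k
      using pu[OF that(1) t0[OF that(2)]] .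
    ultimately have "no_cd_feedback n (\<lambda>j. move 0 j t) i = Some 0"
      using p(1) by (intro no_cd_feedback_SomeI)
    then show ?thesis using feedback_slot(1)[OF i(1)] by simp
  qed
  have x1: "g i (Suc (4 * t)) = None" if i: "i < n" "i \<noteq> p" for i
  proof (rule ccontr)
    assume "g i (Suc (4 * t)) \<noteq> None"
    then obtain m where "no_cd_feedback n (\<lambda>j. move 1 j t) i = Some m"
      using feedback_slot(2)[OF i(1)] by auto
    then have "move 1 i t = Listen" by (rule no_cd_feedback_SomeD(1)[where a = "\<lambda>j. move 1 j t"])
    then show False using np[OF i] x0[OF i]
      by (auto simp: slot_action_def Let_def split: if_splits)
  qed
  have tr2: "i = p" if "i < n" "is_Transmit (move 2 i t)" for i
    using x1[OF that(1)] that(2) by (auto simp: slot_action_def Let_def split: if_splits)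
  have t1: "is_Transmit (move 1 i t) \<longleftrightarrow> r i t = Sender" for i
    by (auto simp: slot_action_def)
  show ?thesis
  proof (cases "\<exists>!i. i < n \<and> r i t = Sender")
    case True
    then obtain q where q: "q < n" "r q t = Sender" "\<And>i. i < n \<Longrightarrow> r i t = Sender \<Longrightarrow> i = q"
      by blast
    have qp: "p \<noteq> q" using q(2) p(3) by auto
    have "move 1 p t = Listen" using p by (simp add: slot_action_def)
    moreover have "move 1 q t = Transmit 0" using q(2) by (simp add: slot_action_def)
    moreover have "k = q" if "k < n" "is_Transmit (move 1 k t)" for k
      using that q(3) t1 by blast
    ultimately have "no_cd_feedback n (\<lambda>j. move 1 j t) p = Some 0"
      using q(1) by (intro no_cd_feedback_SomeI)
    then have x1p: "g p (Suc (4 * t)) = Some 0" using feedback_slot(2)[OF p(1)] by simp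
    have "move 2 q t = Listen" using q(2) by (simp add: slot_action_def)
    moreover have "move 2 p t = Transmit f" using p x1p pf by (simp add: slot_action_def)
    ultimately have "no_cd_feedback n (\<lambda>j. move 2 j t) q = Some f"
      using tr2 p(1) by (intro no_cd_feedback_SomeI)
    then have x2: "g q (Suc (Suc (4 * t))) = Some f" using feedback_slot(3)[OF q(1)] by simp
    have tq: "t \<notin> fst (state q t)" using np[OF q(1)] qp by simp
    have "extends t f q"
      unfolding extends_def
    proof (intro conjI allI impI)
      show "joined q t = (fst (state q t) \<union> {f..<f + c}, f + c)"
        using q(2) x2 tq by (simp add: admit_def)
    next
      fix i assume i: "i < n" "i \<noteq> q"
      then have "r i t \<noteq> Sender" using q(3) by blast
      then show "fst (joined i t) = fst (state i t)" by (simp add: admit_def)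
    next
      fix i assume i: "i < n" "t \<in> fst (state i t)"
      then have "i = p" by (rule pu)
      then show "snd (joined i t) = f + c" using p x1p pf by (simp add: admit_def)
    qed
    then show ?thesis using q(1) by auto
  next
    case False
    have x1p: "g p (Suc (4 * t)) = None"
    proof (rule ccontr)
      assume "g p (Suc (4 * t)) \<noteq> None"
      then obtain m where m: "no_cd_feedback n (\<lambda>j. move 1 j t) p = Some m"
        using feedback_slot(2)[OF p(1)] by auto
      from no_cd_feedback_SomeD(2)[OF m] obtain j where
        j: "j < n" "move 1 j t = Transmit m" "\<forall>k<n. is_Transmit (move 1 k t) \<longrightarrow> k = j" by blast
      have "r j t = Sender" using t1[of j] j(2) by simp
      moreover have "k = j" if "k < n" "r k t = Sender" for k
        using j(3) that t1 by blast
      ultimately show False using False j(1) by blast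
    qed
    have "\<not> is_Transmit (move 2 i t)" if "i < n" for i
    proof
      assume *: "is_Transmit (move 2 i t)"
      then have "i = p" by (rule tr2[OF that])
      then show False using * x1p by (auto simp: slot_action_def Let_def split: if_splits)
    qed
    then have x2: "g i (Suc (Suc (4 * t))) = None" if "i < n" for i
      using feedback_slot(3)[OF that] by (auto simp: no_cd_feedback_def)
    have "joined i t = state i t" if "i < n" for i
    proof (cases "i = p")
      case True
      then show ?thesis using x2[OF that] x1p by (simp add: admit_def)
    next
      case False
      then show ?thesis using x2[OF that] np[OF that] by (simp add: admit_def)
    qed
    moreover have "\<not> good t" using False by (simp add: pairing_def)
    ultimately show ?thesis by simp
  qed
qed

text \<open>The hypothesis includes a holder that is a sender: it is silent in the first round, so
  to the repliers the slot looks like one without a token. Either way an answer gets through exactly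
  in a pairing. It carries \<open>Suc t\<close>, which a sender holding the token ignores in favour
  of its own \<open>f > t\<close>; the expression \<open>max f (Suc t)\<close> covers both
  cases.\<close>

lemma admit_without_holder:
  assumes cov: "covered t f" and no_holder: "\<And>i. i < n \<Longrightarrow> t \<in> fst (state i t) \<Longrightarrow> r i t = Sender"
  shows "(\<not> good t \<and> (\<forall>i<n. joined i t = state i t)) \<or> (\<exists>q<n. extends t (max f (Suc t)) q)"
proof -
  have pu: "i = j" if "i < n" "t \<in> fst (state i t)" "j < n" "t \<in> fst (state j t)" for i j
    using cov that unfolding covered_def by blast
  have pf: "snd (state i t) = f \<and> t < f" if "i < n" "t \<in> fst (state i t)" for i
    using cov that unfolding covered_def by blast
  have nf: "f \<le> t" if "\<And>i. i < n \<Longrightarrow> t \<notin> fst (state i t)"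
    using cov that unfolding covered_def by (meson not_le_imp_less order_refl)
  have x0: "g i (4 * t) = None" if "i < n" for i
    using that no_holder by (auto simp: feedback_slot no_cd_feedback_def slot_action_def split: if_splits)
  have l1: "move 1 i t = Listen \<longleftrightarrow> r i t = Replier" if "i < n" for i
    using that no_holder[of i] x0[of i] by (auto simp: slot_action_def)
  have t1: "move 1 i t = Transmit 0 \<longleftrightarrow> r i t = Sender"
    "is_Transmit (move 1 i t) \<longleftrightarrow> r i t = Sender" for i
    by (auto simp: slot_action_def)
  have x1: "g i (Suc (4 * t)) \<noteq> None \<longleftrightarrow> r i t = Replier \<and> (\<exists>!j. j < n \<and> r j t = Sender)"
    if "i < n" for i
    unfolding feedback_slot(2)[OF that] no_cd_feedback_def t1 l1[OF that] by simp
  have t2: "is_Transmit (move 2 i t) \<longleftrightarrow> r i t = Replier \<and> (\<exists>!j. j < n \<and> r j t = Sender)"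
    "is_Transmit (move 2 i t) \<Longrightarrow> move 2 i t = Transmit (Suc t)"
    if "i < n" for i
    using x1[OF that] no_holder[OF that] by (auto simp: slot_action_def Let_def split: if_splits)
  have l2: "move 2 i t = Listen \<longleftrightarrow> r i t = Sender" for i
    by (auto simp: slot_action_def Let_def split: if_splits)
  have x2: "g i (Suc (Suc (4 * t))) = (if r i t = Sender \<and> good t then Some (Suc t) else None)"
    if i: "i < n" for i
  proof (cases "r i t = Sender \<and> good t")
    case True
    then obtain j where j: "j < n" "r j t = Replier" "\<And>k. k < n \<Longrightarrow> r k t = Replier \<Longrightarrow> k = j"
      unfolding pairing_def by blast
    have u: "\<exists>!j. j < n \<and> r j t = Sender" using True unfolding pairing_def by blast
    have mj: "move 2 j t = Transmit (Suc t)" using t2[OF j(1)] j(2) u by blast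
    have "k = j" if "k < n" "is_Transmit (move 2 k t)" for k
      using t2(1)[OF that(1)] that j(3) by blast
    moreover have "move 2 i t = Listen" using True l2 by blast
    ultimately have "no_cd_feedback n (\<lambda>j. move 2 j t) i = Some (Suc t)"
      using mj j(1) by (intro no_cd_feedback_SomeI)
    then show ?thesis using True i by (simp add: feedback_slot)
  next
    case False
    have "no_cd_feedback n (\<lambda>j. move 2 j t) i = None"
    proof (rule ccontr)
      assume "no_cd_feedback n (\<lambda>j. move 2 j t) i \<noteq> None"
      then obtain m where m: "no_cd_feedback n (\<lambda>j. move 2 j t) i = Some m" by blast
      note D = no_cd_feedback_SomeD[OF m]
      have s: "r i t = Sender" using D(1) l2 by blast
      obtain j where j: "j < n" "move 2 j t = Transmit m" "\<forall>k<n. is_Transmit (move 2 k t) \<longrightarrow> k = j"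
        using D(2) by blast
      have tr: "is_Transmit (move 2 j t)" using j(2) by simp
      have tj: "r j t = Replier" "\<exists>!j. j < n \<and> r j t = Sender" using t2(1)[OF j(1)] tr by blast+
      have "k = j" if "k < n" "r k t = Replier" for k
        using t2(1)[OF that(1)] that tj(2) j(3) by blast
      then have "\<exists>!i. i < n \<and> r i t = Replier"
        using tj(1) j(1) by blast
      then show False using tj(2) s False by (simp add: pairing_def)
    qed
    then show ?thesis using False i by (auto simp: feedback_slot)
  qed
  show ?thesis
  proof (cases "good t")
    case True
    then obtain q where q: "q < n" "r q t = Sender" "\<And>i. i < n \<Longrightarrow> r i t = Sender \<Longrightarrow> i = q"
      unfolding pairing_def by blast
    have reps: "i = q" if "i < n" "t \<in> fst (state i t)" for i
      using q no_holder that by blast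
    have a: "(if t \<in> fst (state q t) then snd (state q t) else Suc t) = max f (Suc t)"
    proof (cases "t \<in> fst (state q t)")
      case True
      then show ?thesis using pf[OF q(1)] by simp
    next
      case False
      then have "f \<le> t" using reps by (intro nf) blast
      then show ?thesis using False by simp
    qed
    have "extends t (max f (Suc t)) q"
      unfolding extends_def
    proof (intro conjI allI impI)
      show "joined q t = (fst (state q t) \<union> {max f (Suc t)..<max f (Suc t) + c}, max f (Suc t) + c)"
      proof -
        have "g q (Suc (Suc (4 * t))) = Some (Suc t)" using q(2) x2[OF q(1)] True by simp
        then show ?thesis
          unfolding admit_def Let_def by (simp only: q(2) a if_True simp_thms option.case)
      qed
    next
      fix i assume "i < n" "i \<noteq> q"
      then have "r i t \<noteq> Sender" "t \<notin> fst (state i t)" using q(3) reps by blast+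
      then show "fst (joined i t) = fst (state i t)" by (simp add: admit_other)
    next
      fix i assume "i < n" "i \<noteq> q" "t \<in> fst (state i t)"
      with reps have False by blast
      then show "snd (joined i t) = max f (Suc t) + c" ..
    qed
    then show ?thesis using q by blast
  next
    case False
    have "joined i t = state i t" if "i < n" for i
      using x2[OF that] False no_holder[OF that] by (auto simp: admit_def)
    with False show ?thesis by simp
  qed
qed

lemma admit_cases:
  assumes cov: "covered t f"
  shows "(\<not> good t \<and> (\<forall>i<n. joined i t = state i t)) \<or> (\<exists>q<n. extends t (max f (Suc t)) q)"
proof (cases "\<exists>p<n. t \<in> fst (state p t) \<and> r p t \<noteq> Sender")
  case True
  then obtain p where p: "p < n" "t \<in> fst (state p t)" "r p t \<noteq> Sender" by blast
  then have "t < f"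
    using cov[unfolded covered_def, THEN conjunct2, THEN conjunct1, rule_format, of t] by blast
  then have "max f (Suc t) = f" by simp
  with admit_with_holder[OF cov p] show ?thesis by (simp only:)
next
  case False
  then have "\<And>i. i < n \<Longrightarrow> t \<in> fst (state i t) \<Longrightarrow> r i t = Sender" by blast
  then show ?thesis by (rule admit_without_holder[OF cov])
qed

text \<open>The invariant is reached in two stages: the first three rounds settle who owns which
  slot, and the fourth brings the right value to the owner of the next slot. A restart after a loss
  appoints from \<open>Suc t > f\<close> on, so it still raises \<open>f\<close> by at least
  \<open>c\<close>.\<close>

lemma covered_Suc:
  assumes cov: "covered t f"
  shows "\<exists>f'. covered (Suc t) f' \<and> f \<le> f' \<and> (good t \<longrightarrow> f + c \<le> f')"
proof -
  define a where "a = max f (Suc t)"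
  have U: "i = j" if "u \<ge> t" "i < n" "j < n" "u \<in> fst (state i t)" "u \<in> fst (state j t)" for u i j
    using cov[unfolded covered_def, THEN conjunct1, rule_format, OF that(1-3)] that(4,5) by simp
  have E: "(\<exists>i<n. u \<in> fst (state i t)) \<longleftrightarrow> u < f" if "u \<ge> t" for u
    using cov[unfolded covered_def, THEN conjunct2, THEN conjunct1] that by simp
  have V: "snd (state i t) = f" if "i < n" "t \<in> fst (state i t)" for i
    using cov[unfolded covered_def, THEN conjunct2, THEN conjunct2] that by simp
  have "\<exists>f'. f' \<ge> a \<and> (good t \<longrightarrow> f' \<ge> a + c) \<and>
      (\<forall>u\<ge>Suc t. \<forall>i<n. \<forall>j<n. u \<in> fst (joined i t) \<and> u \<in> fst (joined j t) \<longrightarrow> i = j) \<and>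
      (\<forall>u\<ge>Suc t. (\<exists>i<n. u \<in> fst (joined i t)) \<longleftrightarrow> u < f') \<and>
      (\<forall>i<n. t \<in> fst (state i t) \<longrightarrow> snd (joined i t) = f') \<and>
      (\<forall>i<n. f \<le> t \<and> Suc t \<in> fst (joined i t) \<longrightarrow> snd (joined i t) = f')"
    using admit_cases[OF cov]
  proof (elim disjE conjE exE)
    assume ng: "\<not> good t" and same: "\<forall>i<n. joined i t = state i t"
    show ?thesis
    \<comment> \<open>If the token is lost, \<open>f\<close> is raised to \<open>Suc t\<close>,
      which still declares no later slot owned; otherwise \<open>a\<close> is
      \<open>f\<close>.\<close>
    proof (intro exI[of _ a] conjI allI impI)
      fix u i j assume "Suc t \<le> u" "i < n" "j < n"
        "u \<in> fst (joined i t) \<and> u \<in> fst (joined j t)"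
      then show "i = j" using U[of u i j] same by auto
    next
      fix u assume "Suc t \<le> u"
      then show "(\<exists>i<n. u \<in> fst (joined i t)) \<longleftrightarrow> u < a" using E[of u] same by (auto simp: a_def)
    next
      fix i assume i: "i < n" "t \<in> fst (state i t)"
      then have "t < f" using E[of t] by blast
      then show "snd (joined i t) = a" using V[OF i] i same by (simp add: a_def)
    next
      fix i assume i: "i < n" "f \<le> t \<and> Suc t \<in> fst (joined i t)"
      then have "Suc t < f" using same E[of "Suc t"] by auto
      with i show "snd (joined i t) = a" by simp
    qed (use ng in auto)
  next
    fix q assume q: "q < n" and ex: "extends t (max f (Suc t)) q"
    have Jq: "joined q t = (fst (state q t) \<union> {a..<a + c}, a + c)"
      and Ji: "\<And>i. i < n \<Longrightarrow> i \<noteq> q \<Longrightarrow> fst (joined i t) = fst (state i t)"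
      and Jr: "\<And>i. i < n \<Longrightarrow> i \<noteq> q \<Longrightarrow> t \<in> fst (state i t) \<Longrightarrow> snd (joined i t) = a + c"
      using ex unfolding extends_def a_def by blast+
    have M: "u \<in> fst (joined i t) \<longleftrightarrow> u \<in> fst (state i t) \<or> i = q \<and> a \<le> u \<and> u < a + c"
      if "i < n" for i u
      using Jq Ji[OF that] by (cases "i = q") auto
    have lt: "u < f" if "u \<ge> t" "i < n" "u \<in> fst (state i t)" for u i
      using E[OF that(1)] that by blast
    have af: "f \<le> a" "Suc t \<le> a" by (auto simp: a_def)
    show ?thesis
    proof (intro exI[of _ "a + c"] conjI allI impI)
      fix u i j assume *: "Suc t \<le> u" "i < n" "j < n"
        "u \<in> fst (joined i t) \<and> u \<in> fst (joined j t)"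
      then have "u \<in> fst (state i t) \<or> i = q \<and> a \<le> u" "u \<in> fst (state j t) \<or> j = q \<and> a \<le> u"
        using M[of i u] M[of j u] * by blast+
      moreover have "k = q" if "a \<le> u" "k < n" "u \<in> fst (joined k t)" for k
        using lt[of u k] M[of k u] * that af by linarith
      moreover have "t \<le> u" using * by simp
      ultimately show "i = j" using U[of u i j] * by blast
    next
      fix u assume u: "Suc t \<le> u"
      show "(\<exists>i<n. u \<in> fst (joined i t)) \<longleftrightarrow> u < a + c"
      proof
        assume "\<exists>i<n. u \<in> fst (joined i t)"
        then obtain i where "i < n" "u \<in> fst (joined i t)" by blast
        then show "u < a + c" using M[of i u] lt[of u i] u af by auto
      next
        assume ua: "u < a + c"
        show "\<exists>i<n. u \<in> fst (joined i t)"
        proof (cases "a \<le> u")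
          case True then show ?thesis using M[OF q, of u] ua q by blast
        next
          case False
          then have "u < f" using u by (auto simp: a_def max_def split: if_splits)
          then show ?thesis using E[of u] u M by auto
        qed
      qed
    next
      fix i assume i: "i < n" "t \<in> fst (state i t)"
      then show "snd (joined i t) = a + c" using Jr[OF i(1) _ i(2)] Jq by (cases "i = q") auto
    next
      fix i assume i: "i < n" "f \<le> t \<and> Suc t \<in> fst (joined i t)"
      then have "i = q" using M[of i "Suc t"] lt[of "Suc t" i] by auto
      then show "snd (joined i t) = a + c" using Jq by simp
    qed auto
  qed
  then obtain f' where f': "f' \<ge> a" "good t \<longrightarrow> f' \<ge> a + c"
    and U': "\<forall>u\<ge>Suc t. \<forall>i<n. \<forall>j<n. u \<in> fst (joined i t) \<and> u \<in> fst (joined j t) \<longrightarrow> i = j"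
    and E': "\<forall>u\<ge>Suc t. (\<exists>i<n. u \<in> fst (joined i t)) \<longleftrightarrow> u < f'"
    and R': "\<forall>i<n. t \<in> fst (state i t) \<longrightarrow> snd (joined i t) = f'"
    and N': "\<forall>i<n. f \<le> t \<and> Suc t \<in> fst (joined i t) \<longrightarrow> snd (joined i t) = f'"
    by (elim exE conjE) (rule that)
  have "snd (state i (Suc t)) = f'" if i: "i < n" and S: "Suc t \<in> fst (joined i t)" for i
  proof (cases "\<exists>p<n. t \<in> fst (state p t)")
    case True
    then obtain p where p: "p < n" "t \<in> fst (state p t)" by blast
    have "is_Transmit (move 3 k t) \<Longrightarrow> t \<in> fst (state k t)" for k
      by (auto simp: slot_action_def Let_def split: if_splits)
    then have tr: "k = p" if "k < n" "is_Transmit (move 3 k t)" for k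
      using U[OF order_refl that(1) p(1) _ p(2)] that(2) by blast
    have mp: "move 3 p t = Transmit f'" using p R' by (simp add: slot_action_def)
    show ?thesis
    proof (cases "i = p")
      \<comment> \<open>A holder that also owns the next slot transmits in the fourth round and
        hears nothing, so it keeps the value it has just computed.\<close>
      case True
      then have "g i (4 * t + 3) = None"
        using feedback_slot(4)[OF p(1)] mp by (simp add: no_cd_feedback_def)
      then show ?thesis using R' p True by simp
    next
      case False
      then have "t \<notin> fst (state i t)" using U[OF order_refl i p(1) _ p(2)] by blast
      then have "move 3 i t = Listen" using S by (simp add: slot_action_def)
      then have "no_cd_feedback n (\<lambda>j. move 3 j t) i = Some f'"
        using mp tr p(1) by (intro no_cd_feedback_SomeI)
      then show ?thesis using feedback_slot(4)[OF i] by simp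
    qed
  next
    case False
    have "\<not> is_Transmit (move 3 k t)" if "k < n" for k
      using that False by (auto simp: slot_action_def Let_def)
    then have "g i (4 * t + 3) = None"
      using feedback_slot(4)[OF i] by (auto simp: no_cd_feedback_def)
    moreover have "f \<le> t" using False E[of t] by simp
    ultimately show ?thesis using N' i S by simp
  qed
  then have "covered (Suc t) f'"
    unfolding covered_def using U' E' by simp
  moreover have "f \<le> f'" "good t \<longrightarrow> f + c \<le> f'"
    using f' by (auto simp: a_def)
  ultimately show ?thesis by blast
qed

text \<open>Deaths of the chain do not hurt this bound: a restart begins beyond the old
  \<open>f\<close>, so the slots skipped meanwhile only increase it.\<close>

lemma covered_ge: "\<exists>f. covered t f \<and> c * card {u. u < t \<and> good u} \<le> f"
proof (induction t)
  case 0
  have "covered 0 0" by (simp add: covered_def)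
  then show ?case by auto
next
  case (Suc t)
  then obtain f where f: "covered t f" "c * card {u. u < t \<and> good u} \<le> f" by blast
  from covered_Suc[OF f(1)] obtain f' where
    f': "covered (Suc t) f'" "f \<le> f'" "good t \<longrightarrow> f + c \<le> f'" by blast
  have "c * card {u. u < Suc t \<and> good u} \<le> f'"
  proof (cases "good t")
    case True
    then have "{u. u < Suc t \<and> good u} = insert t {u. u < t \<and> good u}"
      by (auto simp: less_Suc_eq)
    then show ?thesis using f f' True by simp
  next
    case False
    then have "{u. u < Suc t \<and> good u} = {u. u < t \<and> good u}"
      by (auto simp: less_Suc_eq)
    then show ?thesis using f f' by simp
  qed
  then show ?case using f' by blast
qed

section \<open>Uniqueness, existence and cost of duties\<close>

lemma unique_duty:
  assumes "i < n" "j < n" "t \<in> fst (state i t)" "t \<in> fst (state j t)"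
  shows "i = j"
  using covered_ge[of t] assms unfolding covered_def by blast

lemma duty_exists:
  assumes "t < c * card {u. u < t \<and> good u}"
  shows "\<exists>i<n. t \<in> fst (state i t)"
proof -
  from covered_ge obtain f where f: "covered t f" "c * card {u. u < t \<and> good u} \<le> f" by blast
  then have "t < f" using assms by linarith
  then show ?thesis using f(1) unfolding covered_def by blast
qed

lemma duty_mono: "t \<le> t' \<Longrightarrow> fst (state i t) \<subseteq> fst (state i t')"
proof (induction t' rule: dec_induct)
  case (step m)
  have "fst (state i m) \<subseteq> fst (joined i m)"
    by (auto simp: admit_def Let_def split: option.splits)
  then show ?case using step by auto
qed auto

text \<open>Only a sender acquires duties, at most \<open>c\<close> of them in a slot, so duties can
  be charged to participations.\<close>

lemma duty_finite_card:
  "finite (fst (state i t)) \<and> card (fst (state i t)) \<le> c * card {u. u < t \<and> r i u = Sender}"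
proof (induction t)
  case (Suc t)
  let ?S = "fst (state i t)"
  show ?case
  proof (cases "r i t = Sender")
    case True
    have "{u. u < Suc t \<and> r i u = Sender} = insert t {u. u < t \<and> r i u = Sender}"
      using True by (auto simp: less_Suc_eq)
    then have cd: "c * card {u. u < Suc t \<and> r i u = Sender} = c + c * card {u. u < t \<and> r i u = Sender}"
      by simp
    have "fst (joined i t) = ?S \<or> (\<exists>a. fst (joined i t) = ?S \<union> {a..<a + c})"
      using True by (auto simp: admit_def Let_def split: option.splits)
    then show ?thesis
    proof
      assume "\<exists>a. fst (joined i t) = ?S \<union> {a..<a + c}"
      then obtain a where a: "fst (joined i t) = ?S \<union> {a..<a + c}" by blast
      have "card (?S \<union> {a..<a + c}) \<le> card ?S + c"
        using card_Un_le[of ?S "{a..<a + c}"] by simp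
      then show ?thesis using a Suc cd by simp
    qed (use Suc cd in simp)
  next
    case False
    then have "fst (joined i t) = ?S" by (simp add: admit_def)
    moreover have "{u. u < Suc t \<and> r i u = Sender} = {u. u < t \<and> r i u = Sender}"
      using False by (auto simp: less_Suc_eq)
    ultimately show ?thesis using Suc by simp
  qed
qed simp

text \<open>A device is awake in a slot only if it participates, owns the slot, or owns the next one
  and waits for \<open>F\<close>. Each participation thus pays for itself, for at most
  \<open>c\<close> owned slots and for their \<open>c\<close> predecessors; this is the factor
  \<open>2 * c + 1\<close>, and a slot has four rounds.\<close>

lemma energy_bound:
  assumes i: "i < n"
  shows "card {u. u < 4 * T \<and> round_action c (r i) (g i) u \<noteq> Idle}
    \<le> 4 * (2 * c + 1) * card {t. t < T \<and> r i t \<noteq> Absent}"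
proof -
  let ?S = "fst (state i T)"
  let ?R = "{t. t < T \<and> r i t \<noteq> Absent}"
  let ?Q = "?R \<union> ?S \<union> {t. Suc t \<in> ?S}"
  have fS: "finite ?S" and cS: "card ?S \<le> c * card {u. u < T \<and> r i u = Sender}"
    using duty_finite_card by blast+
  have "card {u. u < T \<and> r i u = Sender} \<le> card ?R"
    by (intro card_mono) auto
  with cS have cS: "card ?S \<le> c * card ?R" by (meson le_trans mult_le_mono2)
  have preS: "finite {t. Suc t \<in> ?S}" "card {t. Suc t \<in> ?S} \<le> card ?S"
proof -
    have "Suc ` {t. Suc t \<in> ?S} \<subseteq> ?S" by auto
    then show "finite {t. Suc t \<in> ?S}" "card {t. Suc t \<in> ?S} \<le> card ?S"
      using fS by (auto intro: inj_on_finite[of Suc] card_inj_on_le[of Suc])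
  qed
  have fQ: "finite ?Q" using fS preS by simp
  have "card ?Q \<le> card ?R + card ?S + card {t. Suc t \<in> ?S}"
    by (meson card_Un_le le_trans add_le_mono1)
  also have "\<dots> \<le> (2 * c + 1) * card ?R" using cS preS by (simp add: algebra_simps)
  finally have cQ: "card ?Q \<le> (2 * c + 1) * card ?R" .
  have sub: "{u. u < 4 * T \<and> round_action c (r i) (g i) u \<noteq> Idle} \<subseteq> (\<lambda>(t, k). 4 * t + k) ` (?Q \<times> {..<4})"
  proof
    fix u assume "u \<in> {u. u < 4 * T \<and> round_action c (r i) (g i) u \<noteq> Idle}"
    then have u: "u < 4 * T" "round_action c (r i) (g i) u \<noteq> Idle" by auto
    define t k where "t = u div 4" and "k = u mod 4"
    have tk: "u = 4 * t + k" "k < 4" "t < T" using u by (auto simp: t_def k_def)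
    have a: "move k i t \<noteq> Idle" using u(2) by (simp add: round_action_def t_def k_def)
    \<comment> \<open>An answer in the third round is triggered by feedback alone; whoever has
      feedback must have listened, hence is a holder or a replier.\<close>
    have g1: "t \<in> fst (state i t) \<or> r i t = Replier" if x1: "g i (Suc (4 * t)) \<noteq> None"
    proof -
      obtain m where "no_cd_feedback n (\<lambda>j. move 1 j t) i = Some m"
        using x1 feedback_slot(2)[OF i] by auto
      then have "move 1 i t = Listen" using no_cd_feedback_SomeD(1) by fastforce
      then show ?thesis by (auto simp: slot_action_def split: if_splits)
    qed
    have "r i t \<noteq> Absent \<or> t \<in> fst (state i t) \<or> Suc t \<in> fst (state i (Suc t))"
      using a g1 by (auto simp: slot_action_def Let_def split: if_splits)
    then have "t \<in> ?Q"
      using duty_mono[of t T i] duty_mono[of "Suc t" T i] tk by (auto simp del: duty.simps)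
    then show "u \<in> (\<lambda>(t, k). 4 * t + k) ` (?Q \<times> {..<4})"
      using tk by force
  qed
  have "card {u. u < 4 * T \<and> round_action c (r i) (g i) u \<noteq> Idle} \<le> card (?Q \<times> {..<4::nat})"
    using fQ by (intro surj_card_le[OF _ sub]) auto
  also have "\<dots> = 4 * card ?Q" by (simp only: card_cartesian_product card_lessThan mult.commute)
  also have "\<dots> \<le> 4 * (2 * c + 1) * card ?R"
    using mult_le_mono2[OF cQ, of 4] by (simp only: mult.assoc)
  finally show ?thesis .
qed

end

subsection \<open>Random roles\<close>

text \<open>Every slot reads its own block of \<open>Suc s\<close> bits, so roles in different slots
  are independent. Participation has probability \<open>(1/2) ^ s\<close> because finitely many fair
  bits realise it exactly; this approximates \<open>1 / N\<close> up to a factor 2.\<close>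

definition device_role :: "nat \<Rightarrow> tape \<Rightarrow> nat \<Rightarrow> role" where
  "device_role s b t =
     (if \<forall>j<s. b (t * Suc s + j) then (if b (t * Suc s + s) then Sender else Replier) else Absent)"

text \<open>Counting uncapped participations avoids a recursion and gives the same result as
  counting the surviving ones, since it is the first \<open>m\<close> that survive.\<close>

definition capped :: "nat \<Rightarrow> (nat \<Rightarrow> role) \<Rightarrow> nat \<Rightarrow> role" where
  "capped m \<rho> t = (if card {u. u < t \<and> \<rho> u \<noteq> Absent} < m then \<rho> t else Absent)"

abbreviation coin :: "bool measure" where
  "coin \<equiv> measure_pmf (bernoulli_pmf (1/2))"

section \<open>Independence of bits, blocks of bits and roles\<close>

lemma space_tape_space: "space tape_space = UNIV"
  by (simp add: tape_space_def space_PiM)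

lemma prob_space_tape_space: "prob_space tape_space"
  unfolding tape_space_def by (rule prob_space_PiM) (rule measure_pmf.prob_space_axioms)

lemma prob_space_tapes_space: "prob_space (tapes_space n)"
  unfolding tapes_space_def by (rule prob_space_PiM) (rule prob_space_tape_space)

lemma measurable_tape_bit: "(\<lambda>b. b k) \<in> measurable tape_space (count_space UNIV)"
proof -
  have "(\<lambda>b. b k) \<in> measurable tape_space coin"
    unfolding tape_space_def by (rule measurable_component_singleton) simp
  then show ?thesis by simp
qed

lemma measurable_tapes_bit:
  assumes "i < n"
  shows "(\<lambda>\<omega>. \<omega> i k) \<in> measurable (tapes_space n) (count_space UNIV)"
proof -
  have "(\<lambda>\<omega>. \<omega> i) \<in> measurable (tapes_space n) tape_space"
    unfolding tapes_space_def by (rule measurable_component_singleton) (use assms in simp)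
  from measurable_compose[OF this measurable_tape_bit] show ?thesis .
qed

text \<open>Such a function factors through finitely many bits, and the product of finitely many
  copies of the discrete space of bits is discrete.\<close>

lemma measurable_finite_prefix:
  assumes "\<And>b b'. (\<And>j. j < l \<Longrightarrow> b j = b' j) \<Longrightarrow> \<phi> b = \<phi> b'"
  shows "\<phi> \<in> measurable tape_space (count_space UNIV)"
proof -
  have fin: "PiM {..<l} (\<lambda>_. count_space UNIV :: bool measure) = count_space (PiE {..<l} (\<lambda>_. UNIV))"
    by (rule count_space_PiM_finite) auto
  have "(\<lambda>b. \<lambda>j\<in>{..<l}. b j) \<in> measurable tape_space (PiM {..<l} (\<lambda>_. count_space UNIV :: bool measure))"
    by (rule measurable_restrict) (rule measurable_tape_bit)
  moreover have "\<phi> \<in> measurable (PiM {..<l} (\<lambda>_. count_space UNIV :: bool measure)) (count_space UNIV)"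
    unfolding fin by simp
  ultimately have "(\<lambda>b. \<phi> (\<lambda>j\<in>{..<l}. b j)) \<in> measurable tape_space (count_space UNIV)"
    by (rule measurable_compose)
  moreover have "\<phi> (\<lambda>j\<in>{..<l}. b j) = \<phi> b" for b
    by (rule assms) simp
  ultimately show ?thesis by simp
qed

lemma emeasure_tape_cylinder:
  assumes "finite J"
  shows "emeasure tape_space {b. \<forall>j\<in>J. b j \<in> A j} = (\<Prod>j\<in>J. emeasure coin (A j))"
proof -
  interpret product_prob_space "\<lambda>_::nat. coin" UNIV
    by (rule product_prob_spaceI) (rule measure_pmf.prob_space_axioms)
  show ?thesis
    using emeasure_PiM_Collect[of J A] assms unfolding tape_space_def by (simp add: space_PiM)
qed

lemma sets_tape_cylinder:
  assumes "finite J"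
  shows "{b. \<forall>j\<in>J. b j \<in> A j} \<in> sets tape_space"
proof (cases "J = {}")
  case True
  then show ?thesis using sets.top[of tape_space] by (simp add: space_tape_space)
next
  case False
  have "(\<lambda>b. b j) -` A j \<inter> space tape_space \<in> sets tape_space" for j
    by (rule measurable_sets[OF measurable_tape_bit]) simp
  then have "(\<Inter>j\<in>J. (\<lambda>b. b j) -` A j \<inter> space tape_space) \<in> sets tape_space"
    using assms False by (intro sets.finite_INT)
  moreover have "(\<Inter>j\<in>J. (\<lambda>b. b j) -` A j \<inter> space tape_space) = {b. \<forall>j\<in>J. b j \<in> A j}"
    using False by (auto simp: space_tape_space)
  ultimately show ?thesis by simp
qed

text \<open>The space is a product of products. Sorting the constraints by device, the outer finite
  product yields one factor per device, and the cylinder formula for a single tape splits each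
  factor.\<close>

lemma emeasure_tapes_cylinder:
  assumes J: "finite J" "J \<subseteq> {..<n} \<times> UNIV"
  shows "emeasure (tapes_space n) {\<omega> \<in> space (tapes_space n). \<forall>k\<in>J. \<omega> (fst k) (snd k) \<in> A k}
    = (\<Prod>k\<in>J. emeasure coin (A k))"
proof -
  interpret finite_product_prob_space "\<lambda>_::nat. tape_space" "{..<n}"
  proof -
    interpret prob_space tape_space by (rule prob_space_tape_space)
    show "finite_product_prob_space (\<lambda>_::nat. tape_space) {..<n}"
      by unfold_locales auto
  qed
  define J' where "J' i = {j. (i, j) \<in> J}" for i
  have fJ': "finite (J' i)" for i
    using finite_vimageI[OF J(1), of "Pair i"] by (simp add: J'_def vimage_def inj_on_def)
  have "{\<omega> \<in> space (tapes_space n). \<forall>k\<in>J. \<omega> (fst k) (snd k) \<in> A k}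
      = PiE {..<n} (\<lambda>i. {b. \<forall>j\<in>J' i. b j \<in> A (i, j)})"
  proof (rule set_eqI)
    fix \<omega> :: "nat \<Rightarrow> tape"
    have sp: "space (tapes_space n) = PiE {..<n} (\<lambda>_. UNIV)"
      by (simp add: tapes_space_def space_PiM space_tape_space)
    have "(\<forall>k\<in>J. \<omega> (fst k) (snd k) \<in> A k) \<longleftrightarrow> (\<forall>i\<in>{..<n}. \<forall>j\<in>J' i. \<omega> i j \<in> A (i, j))"
    proof
      assume *: "\<forall>i\<in>{..<n}. \<forall>j\<in>J' i. \<omega> i j \<in> A (i, j)"
      show "\<forall>k\<in>J. \<omega> (fst k) (snd k) \<in> A k"
      proof
        fix k assume "k \<in> J"
        then have "fst k \<in> {..<n}" "snd k \<in> J' (fst k)" using J(2) by (auto simp: J'_def)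
        with * have "\<omega> (fst k) (snd k) \<in> A (fst k, snd k)" by blast
        then show "\<omega> (fst k) (snd k) \<in> A k" by simp
      qed
    qed (force simp: J'_def)
    then show "\<omega> \<in> {\<omega> \<in> space (tapes_space n). \<forall>k\<in>J. \<omega> (fst k) (snd k) \<in> A k} \<longleftrightarrow>
        \<omega> \<in> PiE {..<n} (\<lambda>i. {b. \<forall>j\<in>J' i. b j \<in> A (i, j)})"
      unfolding sp PiE_iff by (simp add: conj_commute)
  qed
  then have "emeasure (tapes_space n) {\<omega> \<in> space (tapes_space n). \<forall>k\<in>J. \<omega> (fst k) (snd k) \<in> A k}
      = (\<Prod>i<n. emeasure tape_space {b. \<forall>j\<in>J' i. b j \<in> A (i, j)})"
    unfolding tapes_space_def
    by (simp add: emeasure_PiM sets_tape_cylinder[OF fJ'])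
  also have "\<dots> = (\<Prod>i<n. \<Prod>j\<in>J' i. emeasure coin (A (i, j)))"
    by (simp add: emeasure_tape_cylinder[OF fJ'])
  also have "\<dots> = (\<Prod>k\<in>Sigma {..<n} J'. emeasure coin (A k))"
    by (subst prod.Sigma) (simp_all add: fJ' case_prod_beta)
  also have "Sigma {..<n} J' = J" using J(2) by (auto simp: J'_def)
  finally show ?thesis .
qed

text \<open>Independence is a statement about finite index sets, where it is the cylinder formula.
  It flattens the nested product into one family indexed by device and position.\<close>

lemma indep_vars_bits:
  "prob_space.indep_vars (tapes_space n) (\<lambda>_. count_space UNIV) (\<lambda>k \<omega>. \<omega> (fst k) (snd k))
     ({..<n} \<times> UNIV)"
proof -
  interpret prob_space "tapes_space n" by (rule prob_space_tapes_space)
  let ?X = "\<lambda>k \<omega>. \<omega> (fst k) (snd k) :: bool"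
  have cyl: "prob {\<omega> \<in> space (tapes_space n). \<forall>k\<in>J. ?X k \<omega> \<in> A k} = (\<Prod>k\<in>J. measure coin (A k))"
    if "finite J" "J \<subseteq> {..<n} \<times> UNIV" for J A
    using emeasure_tapes_cylinder[OF that, of A]
    by (simp add: emeasure_eq_measure measure_pmf.emeasure_eq_measure prod_ennreal prod_nonneg)
  show ?thesis
    unfolding indep_vars_def2
  proof (intro conjI ballI indep_setsI)
    fix k assume "k \<in> {..<n} \<times> (UNIV :: nat set)"
    then show rv: "?X k \<in> measurable (tapes_space n) (count_space UNIV)"
      by (auto intro: measurable_tapes_bit)
    then show "{?X k -` A \<inter> space (tapes_space n) |A. A \<in> sets (count_space UNIV)} \<subseteq> events"
      by (auto intro: measurable_sets)
  next
    fix B J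
    assume J: "J \<noteq> {}" "J \<subseteq> {..<n} \<times> (UNIV :: nat set)" "finite J"
      and B: "\<forall>k\<in>J. B k \<in> {?X k -` A \<inter> space (tapes_space n) |A. A \<in> sets (count_space UNIV)}"
    have "\<exists>A. B k = ?X k -` A \<inter> space (tapes_space n)" if "k \<in> J" for k
      using bspec[OF B that] by (elim CollectE exE conjE) (rule exI)
    then have "\<forall>k\<in>J. \<exists>A. B k = ?X k -` A \<inter> space (tapes_space n)" by (rule ballI)
    from bchoice[OF this] obtain A where "\<forall>k\<in>J. B k = ?X k -` A k \<inter> space (tapes_space n)" ..
    note A = bspec[OF this]
    have "(\<Inter>k\<in>J. B k) = {\<omega> \<in> space (tapes_space n). \<forall>k\<in>J. ?X k \<omega> \<in> A k}"
      using J(1) by (auto simp: A)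
    moreover have "prob (B k) = measure coin (A k)" if "k \<in> J" for k
    proof -
      have "B k = {\<omega> \<in> space (tapes_space n). \<forall>k'\<in>{k}. ?X k' \<omega> \<in> A k'}"
        unfolding A[OF that] by auto
      moreover have "{k} \<subseteq> {..<n} \<times> UNIV" using J(2) that by blast
      ultimately show ?thesis using cyl[of "{k}" A] by simp
    qed
    ultimately show "prob (\<Inter>k\<in>J. B k) = (\<Prod>k\<in>J. prob (B k))"
      using cyl[OF J(3,2), of A] by simp
  qed
qed

text \<open>Each \<open>\<phi> l\<close> takes the whole family, and \<open>dep\<close> says which
  entries it reads, so that applications need no explicit restrictions. Its measurability is
  automatic: a finite product of countable discrete spaces is discrete.\<close>

lemma (in prob_space) indep_vars_blocks:
  fixes Y :: "'i \<Rightarrow> 'a \<Rightarrow> 'b::countable"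
  assumes ind: "indep_vars (\<lambda>_. count_space UNIV) Y I"
    and K: "\<And>l. l \<in> L \<Longrightarrow> K l \<subseteq> I" "\<And>l. l \<in> L \<Longrightarrow> finite (K l)" "disjoint_family_on K L"
    and N: "space N = UNIV"
    and dep: "\<And>l y y'. l \<in> L \<Longrightarrow> (\<And>k. k \<in> K l \<Longrightarrow> y k = y' k) \<Longrightarrow> \<phi> l y = \<phi> l y'"
  shows "indep_vars (\<lambda>_. N) (\<lambda>l \<omega>. \<phi> l (\<lambda>k. Y k \<omega>)) L"
proof -
  have "indep_vars (\<lambda>l. PiM (K l) (\<lambda>_. count_space UNIV)) (\<lambda>l \<omega>. restrict (\<lambda>k. Y k \<omega>) (K l)) L"
    by (rule indep_vars_restrict[OF ind K(1,3)])
  then have "indep_vars (\<lambda>_. N) (\<lambda>l \<omega>. \<phi> l (restrict (\<lambda>k. Y k \<omega>) (K l))) L"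
  proof (rule indep_vars_compose2)
    fix l assume "l \<in> L"
    have "PiM (K l) (\<lambda>_. count_space UNIV :: 'b measure) = count_space (PiE (K l) (\<lambda>_. UNIV))"
      by (rule count_space_PiM_finite) (use K(2)[OF \<open>l \<in> L\<close>] in auto)
    then show "\<phi> l \<in> measurable (PiM (K l) (\<lambda>_. count_space UNIV)) N"
      using N by simp
  qed
  moreover have "\<phi> l (restrict (\<lambda>k. Y k \<omega>) (K l)) = \<phi> l (\<lambda>k. Y k \<omega>)" if "l \<in> L" for l \<omega>
    by (rule dep[OF that]) simp
  ultimately show ?thesis
    by (subst indep_vars_cong[where Y = "\<lambda>l \<omega>. \<phi> l (restrict (\<lambda>k. Y k \<omega>) (K l))"]) auto
qed

text \<open>The grid of roles, with devices as rows and slots as columns, will be cut in three ways: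
  into single entries of one row for the participations, into rows for the excess over the cap, and
  into columns for the pairings.\<close>

lemma (in prob_space) expectation_prod_blocks:
  fixes Y :: "'i \<Rightarrow> 'a \<Rightarrow> 'b::countable" and \<phi> :: "'l \<Rightarrow> ('i \<Rightarrow> 'b) \<Rightarrow> real"
  assumes ind: "indep_vars (\<lambda>_. count_space UNIV) Y I"
    and K: "\<And>l. l \<in> L \<Longrightarrow> K l \<subseteq> I" "\<And>l. l \<in> L \<Longrightarrow> finite (K l)" "disjoint_family_on K L"
    and dep: "\<And>l y y'. l \<in> L \<Longrightarrow> (\<And>k. k \<in> K l \<Longrightarrow> y k = y' k) \<Longrightarrow> \<phi> l y = \<phi> l y'"
    and bnd: "\<And>l y. l \<in> L \<Longrightarrow> \<bar>\<phi> l y\<bar> \<le> B"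
    and L: "finite L"
  shows "expectation (\<lambda>\<omega>. \<Prod>l\<in>L. \<phi> l (\<lambda>k. Y k \<omega>)) = (\<Prod>l\<in>L. expectation (\<lambda>\<omega>. \<phi> l (\<lambda>k. Y k \<omega>)))"
    and "integrable M (\<lambda>\<omega>. \<Prod>l\<in>L. \<phi> l (\<lambda>k. Y k \<omega>))"
    and "\<And>l. l \<in> L \<Longrightarrow> integrable M (\<lambda>\<omega>. \<phi> l (\<lambda>k. Y k \<omega>))"
proof -
  have iv: "indep_vars (\<lambda>_. borel) (\<lambda>l \<omega>. \<phi> l (\<lambda>k. Y k \<omega>)) L"
    by (rule indep_vars_blocks[OF ind K _ dep]) auto
  then have rv: "random_variable borel (\<lambda>\<omega>. \<phi> l (\<lambda>k. Y k \<omega>))" if "l \<in> L" for l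
    using that by (auto simp: indep_vars_def2)
  show int: "integrable M (\<lambda>\<omega>. \<phi> l (\<lambda>k. Y k \<omega>))" if "l \<in> L" for l
    by (rule integrable_const_bound[where B = B]) (use rv[OF that] bnd[OF that] in auto)
  show "expectation (\<lambda>\<omega>. \<Prod>l\<in>L. \<phi> l (\<lambda>k. Y k \<omega>)) = (\<Prod>l\<in>L. expectation (\<lambda>\<omega>. \<phi> l (\<lambda>k. Y k \<omega>)))"
    by (rule indep_vars_lebesgue_integral[OF L iv int])
  show "integrable M (\<lambda>\<omega>. \<Prod>l\<in>L. \<phi> l (\<lambda>k. Y k \<omega>))"
    by (rule indep_vars_integrable[OF L iv int])
qed

lemma indep_vars_roles:
  "prob_space.indep_vars (tapes_space n) (\<lambda>_. count_space UNIV)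
     (\<lambda>k \<omega>. device_role s (\<omega> (fst k)) (snd k)) ({..<n} \<times> UNIV)"
proof -
  interpret prob_space "tapes_space n" by (rule prob_space_tapes_space)
  define \<phi> where "\<phi> k y = device_role s (\<lambda>j. y (fst k, j)) (snd k)" for k :: "nat \<times> nat" and y
  define K where "K k = {fst k} \<times> {snd k * Suc s..<snd k * Suc s + Suc s}" for k :: "nat \<times> nat"
  have "indep_vars (\<lambda>_. count_space UNIV) (\<lambda>k \<omega>. \<phi> k (\<lambda>k. \<omega> (fst k) (snd k))) ({..<n} \<times> UNIV)"
  proof (rule indep_vars_blocks[OF indep_vars_bits])
    show "disjoint_family_on K ({..<n} \<times> UNIV)"
      unfolding disjoint_family_on_def
    proof (intro ballI impI)
      fix k l :: "nat \<times> nat" assume "k \<noteq> l"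
      show "K k \<inter> K l = {}"
      proof (cases "fst k = fst l")
        case True
        then have "snd k < snd l \<or> snd l < snd k" using \<open>k \<noteq> l\<close> by (metis linorder_neqE_nat prod_eqI)
        then have "snd k * Suc s + Suc s \<le> snd l * Suc s \<or> snd l * Suc s + Suc s \<le> snd k * Suc s"
          by (metis Suc_leI add.commute mult_Suc mult_le_mono1)
        then show ?thesis by (auto simp: K_def)
      qed (auto simp: K_def)
    qed
    fix k y y' assume *: "\<And>j. j \<in> K k \<Longrightarrow> y j = (y' j :: bool)"
    have "y (fst k, j) = y' (fst k, j)" if "snd k * Suc s \<le> j" "j \<le> snd k * Suc s + s" for j
      using that by (intro *) (auto simp: K_def)
    then show "\<phi> k y = \<phi> k y'" by (simp add: \<phi>_def device_role_def)
  qed (auto simp: K_def)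
  then show ?thesis by (simp add: \<phi>_def)
qed

lemma prob_role:
  assumes "i < n"
  shows "\<P>(\<omega> in tapes_space n. device_role s (\<omega> i) t = Sender) = (1/2) ^ Suc s"
    and "\<P>(\<omega> in tapes_space n. device_role s (\<omega> i) t = Replier) = (1/2) ^ Suc s"
    and "\<P>(\<omega> in tapes_space n. device_role s (\<omega> i) t \<noteq> Absent) = (1/2) ^ s"
    and "\<P>(\<omega> in tapes_space n. device_role s (\<omega> i) t = Absent) = 1 - (1/2) ^ s"
proof -
  interpret prob_space "tapes_space n" by (rule prob_space_tapes_space)
  have cyl: "prob {\<omega> \<in> space (tapes_space n). \<forall>j\<in>J. \<omega> i (t * Suc s + j) = v j} = (1/2) ^ card J"
    if "finite J" for J v
  proof -
    let ?J = "(\<lambda>j. (i, t * Suc s + j)) ` J"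
    have "emeasure (tapes_space n) {\<omega> \<in> space (tapes_space n). \<forall>k\<in>?J. \<omega> (fst k) (snd k) \<in> {v (snd k - t * Suc s)}}
      = (\<Prod>k\<in>?J. emeasure coin {v (snd k - t * Suc s)})"
      using that assms by (intro emeasure_tapes_cylinder) auto
    also have "\<dots> = (\<Prod>k\<in>?J. ennreal (1/2))"
      by (intro prod.cong refl) (simp add: measure_pmf.emeasure_eq_measure measure_pmf_single)
    also have "\<dots> = ennreal (1/2) ^ card J"
      by (simp only: prod_constant card_image inj_on_def) (simp add: card_image inj_on_def)
    also have "\<dots> = ennreal ((1/2) ^ card J)" by (rule ennreal_power) simp
    finally have "prob {\<omega> \<in> space (tapes_space n). \<forall>k\<in>?J. \<omega> (fst k) (snd k) \<in> {v (snd k - t * Suc s)}}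
        = (1/2) ^ card J"
      unfolding emeasure_eq_measure by (subst (asm) ennreal_inj) auto
    then show ?thesis by simp
  qed
  have S_iff: "device_role s b t = Sender \<longleftrightarrow> (\<forall>j\<in>{..<Suc s}. b (t * Suc s + j) = True)" for b
    by (auto simp: device_role_def lessThan_Suc)
  have R_iff: "device_role s b t = Replier \<longleftrightarrow> (\<forall>j\<in>{..<Suc s}. b (t * Suc s + j) = (j < s))" for b
    by (auto simp: device_role_def lessThan_Suc)
  have N_iff: "device_role s b t \<noteq> Absent \<longleftrightarrow> (\<forall>j\<in>{..<s}. b (t * Suc s + j) = True)" for b
    by (auto simp: device_role_def)
  show S: "\<P>(\<omega> in tapes_space n. device_role s (\<omega> i) t = Sender) = (1/2) ^ Suc s"
    using cyl[of "{..<Suc s}" "\<lambda>j. True"] unfolding S_iff by (simp only: finite_lessThan card_lessThan)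
  show R: "\<P>(\<omega> in tapes_space n. device_role s (\<omega> i) t = Replier) = (1/2) ^ Suc s"
    using cyl[of "{..<Suc s}" "\<lambda>j. j < s"] unfolding R_iff by (simp only: finite_lessThan card_lessThan)
  show N: "\<P>(\<omega> in tapes_space n. device_role s (\<omega> i) t \<noteq> Absent) = (1/2) ^ s"
    using cyl[of "{..<s}" "\<lambda>j. True"] unfolding N_iff by (simp only: finite_lessThan card_lessThan)
  have "(\<lambda>\<omega>. device_role s (\<omega> i) t) \<in> measurable (tapes_space n) (count_space UNIV)"
    using indep_vars_roles[of n s, unfolded indep_vars_def2, THEN conjunct1, rule_format, of "(i, t)"]
      assms by simp
  from measurable_sets[OF this, of "{Absent}"]
  have "{\<omega> \<in> space (tapes_space n). device_role s (\<omega> i) t = Absent} \<in> events"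
    by (simp add: vimage_def Int_def conj_commute)
  then show "\<P>(\<omega> in tapes_space n. device_role s (\<omega> i) t = Absent) = 1 - (1/2) ^ s"
    using prob_neg[of "\<lambda>\<omega>. device_role s (\<omega> i) t = Absent"] N by simp
qed

section \<open>Moments of participation counts\<close>

definition participations :: "nat \<Rightarrow> nat \<Rightarrow> tape \<Rightarrow> nat" where
  "participations s l b = card {t. t < l \<and> device_role s b t \<noteq> Absent}"

lemma measurable_role:
  assumes "i < n"
  shows "(\<lambda>\<omega>. device_role s (\<omega> i) t) \<in> measurable (tapes_space n) (count_space UNIV)"
proof -
  interpret prob_space "tapes_space n" by (rule prob_space_tapes_space)
  show ?thesis
    using indep_vars_roles[of n s, unfolded indep_vars_def2, THEN conjunct1, rule_format, of "(i, t)"]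
      assms by simp
qed

lemma (in prob_space) expectation_of_bool:
  assumes "{\<omega> \<in> space M. P \<omega>} \<in> events"
  shows "expectation (\<lambda>\<omega>. of_bool (P \<omega>)) = \<P>(\<omega> in M. P \<omega>)"
    and "integrable M (\<lambda>\<omega>. of_bool (P \<omega>) :: real)"
proof -
  have eq: "of_bool (P \<omega>) = (indicator {\<omega> \<in> space M. P \<omega>} \<omega> :: real)" if "\<omega> \<in> space M" for \<omega>
    using that by (simp add: indicator_def)
  have "expectation (\<lambda>\<omega>. of_bool (P \<omega>) :: real) = expectation (indicator {\<omega> \<in> space M. P \<omega>})"
    by (rule Bochner_Integration.integral_cong[OF refl eq])
  also have "\<dots> = \<P>(\<omega> in M. P \<omega>)" using assms by simp
  finally show "expectation (\<lambda>\<omega>. of_bool (P \<omega>)) = \<P>(\<omega> in M. P \<omega>)" .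
  have "integrable M (indicator {\<omega> \<in> space M. P \<omega>} :: _ \<Rightarrow> real)"
    using assms by (simp add: emeasure_eq_measure)
  then show "integrable M (\<lambda>\<omega>. of_bool (P \<omega>) :: real)"
    by (subst Bochner_Integration.integrable_cong[OF refl eq])
qed

lemma expectation_active:
  assumes "i < n"
  shows "(\<integral>\<omega>. of_bool (device_role s (\<omega> i) t \<noteq> Absent) \<partial>tapes_space n) = (1/2 :: real) ^ s"
    and "integrable (tapes_space n) (\<lambda>\<omega>. of_bool (device_role s (\<omega> i) t \<noteq> Absent) :: real)"
proof -
  interpret prob_space "tapes_space n" by (rule prob_space_tapes_space)
  from measurable_sets[OF measurable_role[OF assms], of "- {Absent}"]
  have "{\<omega> \<in> space (tapes_space n). device_role s (\<omega> i) t \<noteq> Absent} \<in> events"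
    by (simp add: vimage_def Int_def conj_commute)
  from expectation_of_bool[OF this] prob_role(3)[OF assms]
  show "(\<integral>\<omega>. of_bool (device_role s (\<omega> i) t \<noteq> Absent) \<partial>tapes_space n) = (1/2 :: real) ^ s"
    "integrable (tapes_space n) (\<lambda>\<omega>. of_bool (device_role s (\<omega> i) t \<noteq> Absent) :: real)"
    by simp_all
qed

lemma card_less_eq_sum:
  fixes l :: nat
  shows "real (card {t. t < l \<and> P t}) = (\<Sum>t<l. of_bool (P t))"
proof -
  have "{t. t < l \<and> P t} = {..<l} \<inter> {t. P t}" by auto
  then have "real (card {t. t < l \<and> P t}) = real (card ({..<l} \<inter> {t. P t}))" by (simp only:)
  also have "\<dots> = (\<Sum>t<l. of_bool (P t))" by (subst sum_of_bool_eq) simp_all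
  finally show ?thesis .
qed

lemma power_card_less_eq_prod:
  fixes l :: nat
  shows "(x::real) ^ card {t. t < l \<and> P t} = (\<Prod>t<l. if P t then x else 1)"
proof -
  have "{t. t < l \<and> P t} = {..<l} \<inter> {t. P t}" by auto
  then show ?thesis by (simp only: prod.If_cases finite_lessThan) simp
qed

lemma expectation_participations:
  assumes "i < n"
  shows "(\<integral>\<omega>. real (participations s l (\<omega> i)) \<partial>tapes_space n) = l * (1/2) ^ s"
    and "integrable (tapes_space n) (\<lambda>\<omega>. real (participations s l (\<omega> i)))"
proof -
  note A = expectation_active[OF assms]
  show "integrable (tapes_space n) (\<lambda>\<omega>. real (participations s l (\<omega> i)))"
    unfolding participations_def card_less_eq_sum by (intro Bochner_Integration.integrable_sum A(2))
  have "(\<integral>\<omega>. real (participations s l (\<omega> i)) \<partial>tapes_space n)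
      = (\<Sum>t<l. \<integral>\<omega>. of_bool (device_role s (\<omega> i) t \<noteq> Absent) \<partial>tapes_space n)"
    unfolding participations_def card_less_eq_sum by (intro Bochner_Integration.integral_sum A(2))
  also have "\<dots> = (\<Sum>t<l. (1/2) ^ s)" by (simp only: A(1))
  finally show "(\<integral>\<omega>. real (participations s l (\<omega> i)) \<partial>tapes_space n) = l * (1/2) ^ s" by simp
qed

lemma expectation_power_participations:
  assumes "i < n"
  shows "(\<integral>\<omega>. 4 ^ participations s l (\<omega> i) \<partial>tapes_space n) = (1 + 3 * (1/2 :: real) ^ s) ^ l"
    and "integrable (tapes_space n) (\<lambda>\<omega>. 4 ^ participations s l (\<omega> i) :: real)"
proof -
  interpret prob_space "tapes_space n" by (rule prob_space_tapes_space)
  define \<phi> :: "nat \<Rightarrow> (nat \<times> nat \<Rightarrow> role) \<Rightarrow> real" where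
    "\<phi> t y = (if y (i, t) \<noteq> Absent then 4 else 1)" for t y
  let ?Y = "\<lambda>k (\<omega> :: nat \<Rightarrow> tape). device_role s (\<omega> (fst k)) (snd k)"
  note E = expectation_prod_blocks[OF indep_vars_roles[of n s], where L = "{..<l}"
      and K = "\<lambda>t. {(i, t)}" and \<phi> = \<phi> and B = 4]
  have K: "\<And>t. t \<in> {..<l} \<Longrightarrow> {(i, t)} \<subseteq> {..<n} \<times> UNIV" "disjoint_family_on (\<lambda>t. {(i, t)}) {..<l}"
    using assms by (auto simp: disjoint_family_on_def)
  have P: "4 ^ participations s l (\<omega> i) = (\<Prod>t<l. \<phi> t (\<lambda>k. ?Y k \<omega>))" for \<omega>
    by (simp add: participations_def power_card_less_eq_prod \<phi>_def)
  have 1: "expectation (\<lambda>\<omega>. \<phi> t (\<lambda>k. ?Y k \<omega>)) = 1 + 3 * (1/2) ^ s" for t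
  proof -
    have "\<phi> t (\<lambda>k. ?Y k \<omega>) = 1 + 3 * of_bool (device_role s (\<omega> i) t \<noteq> Absent)" for \<omega>
      by (simp add: \<phi>_def)
    then show ?thesis
      using expectation_active[OF assms, of s t] by (simp add: prob_space)
  qed
  show "(\<integral>\<omega>. 4 ^ participations s l (\<omega> i) \<partial>tapes_space n) = (1 + 3 * (1/2 :: real) ^ s) ^ l"
  proof -
    have "(\<integral>\<omega>. 4 ^ participations s l (\<omega> i) \<partial>tapes_space n)
        = (\<Prod>t<l. expectation (\<lambda>\<omega>. \<phi> t (\<lambda>k. ?Y k \<omega>)))"
      unfolding P by (rule E(1)) (use K in \<open>auto simp: \<phi>_def\<close>)
    then show ?thesis by (simp only: 1) simp
  qed
  show "integrable (tapes_space n) (\<lambda>\<omega>. 4 ^ participations s l (\<omega> i) :: real)"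
    unfolding P by (rule E(2)) (use K in \<open>auto simp: \<phi>_def\<close>)
qed

text \<open>
  The numerator vanishes at \<open>x = 0\<close>, so for a rarely active device the expectation of the left-hand
  side exceeds 1 only by a multiple of the expected activity.
\<close>

lemma two_power_diff_le: "(2::real) ^ (x - m) \<le> 1 + (4 ^ x - 1) / 2 ^ m"
proof (cases "x \<le> m")
  case True
  have "(1::real) \<le> 4 ^ x" by simp
  then have "0 \<le> (4 ^ x - 1) / (2::real) ^ m" by simp
  with True show ?thesis by simp
next
  case False
  have "(2::real) ^ (x - m) = 2 ^ x / 2 ^ m" using False by (simp add: power_diff)
  moreover have "(2::real) ^ x \<le> 2 ^ m + (4 ^ x - 1)"
  proof -
    have "(4::real) ^ x = 2 ^ x * 2 ^ x" by (simp flip: power_mult_distrib)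
    moreover have "(2::real) ^ x * 1 \<le> 2 ^ x * 2 ^ x" by (rule mult_left_mono) simp_all
    moreover have "(1::real) \<le> 2 ^ m" by simp
    ultimately show ?thesis by linarith
  qed
  ultimately show ?thesis by (simp add: field_simps)
qed

text \<open>The natural subtraction makes each summand the number of participations that the cap
  \<open>m\<close> takes from device \<open>i\<close>. Different devices read different rows of the
  grid of roles, so the exponential moment of the sum is a product, ready for Markov's
  inequality.\<close>

lemma expectation_excess:
  shows "(\<integral>\<omega>. 2 ^ (\<Sum>i<n. participations s l (\<omega> i) - m) \<partial>tapes_space n)
      \<le> (1 + ((1 + 3 * (1/2 :: real) ^ s) ^ l - 1) / 2 ^ m) ^ n"
    and "integrable (tapes_space n) (\<lambda>\<omega>. 2 ^ (\<Sum>i<n. participations s l (\<omega> i) - m) :: real)"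
proof -
  interpret prob_space "tapes_space n" by (rule prob_space_tapes_space)
  define \<phi> :: "nat \<Rightarrow> (nat \<times> nat \<Rightarrow> role) \<Rightarrow> real" where
    "\<phi> i y = 2 ^ (card {t. t < l \<and> y (i, t) \<noteq> Absent} - m)" for i y
  let ?Y = "\<lambda>k (\<omega> :: nat \<Rightarrow> tape). device_role s (\<omega> (fst k)) (snd k)"
  note E = expectation_prod_blocks[OF indep_vars_roles[of n s], where L = "{..<n}"
      and K = "\<lambda>i. {i} \<times> {..<l}" and \<phi> = \<phi> and B = "2 ^ l"]
  have K: "\<And>i. i \<in> {..<n} \<Longrightarrow> {i} \<times> {..<l} \<subseteq> {..<n} \<times> UNIV"
    "\<And>i. i \<in> {..<n} \<Longrightarrow> finite ({i} \<times> {..<l})"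
    "disjoint_family_on (\<lambda>i. {i} \<times> {..<l}) {..<n}"
    by (auto simp: disjoint_family_on_def)
  have dep: "\<phi> i y = \<phi> i y'" if "\<And>k. k \<in> {i} \<times> {..<l} \<Longrightarrow> y k = y' k" for i y y'
  proof -
    have "{t. t < l \<and> y (i, t) \<noteq> Absent} = {t. t < l \<and> y' (i, t) \<noteq> Absent}" using that by auto
    then show ?thesis by (simp add: \<phi>_def)
  qed
  have bnd: "\<bar>\<phi> i y\<bar> \<le> 2 ^ l" for i y
  proof -
    have "card {t. t < l \<and> y (i, t) \<noteq> Absent} \<le> card {..<l}" by (rule card_mono) auto
    then have "card {t. t < l \<and> y (i, t) \<noteq> Absent} - m \<le> l" by simp
    then show ?thesis by (simp add: \<phi>_def power_increasing)
  qed
  have P: "2 ^ (\<Sum>i<n. participations s l (\<omega> i) - m) = (\<Prod>i<n. \<phi> i (\<lambda>k. ?Y k \<omega>))" for \<omega>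
    by (simp add: participations_def power_sum \<phi>_def)
  note E = E[OF K dep bnd finite_lessThan]
  have 1: "expectation (\<lambda>\<omega>. \<phi> i (\<lambda>k. ?Y k \<omega>)) \<le> 1 + ((1 + 3 * (1/2) ^ s) ^ l - 1) / 2 ^ m"
    if "i < n" for i
  proof -
    note X = expectation_power_participations[OF that, of s l]
    have "expectation (\<lambda>\<omega>. \<phi> i (\<lambda>k. ?Y k \<omega>))
        \<le> expectation (\<lambda>\<omega>. 1 + (4 ^ participations s l (\<omega> i) - 1) / 2 ^ m)"
    proof (rule integral_mono)
      show "integrable (tapes_space n) (\<lambda>\<omega>. \<phi> i (\<lambda>k. ?Y k \<omega>))"
        using E(3) that by simp
      show "integrable (tapes_space n) (\<lambda>\<omega>. 1 + (4 ^ participations s l (\<omega> i) - 1) / 2 ^ m :: real)"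
        using X(2) by simp
    qed (simp add: \<phi>_def participations_def two_power_diff_le)
    also have "\<dots> = 1 + ((1 + 3 * (1/2) ^ s) ^ l - 1) / 2 ^ m"
      using X by (simp add: prob_space)
    finally show ?thesis .
  qed
  have "(\<integral>\<omega>. 2 ^ (\<Sum>i<n. participations s l (\<omega> i) - m) \<partial>tapes_space n)
      = (\<Prod>i<n. expectation (\<lambda>\<omega>. \<phi> i (\<lambda>k. ?Y k \<omega>)))"
    unfolding P by (rule E(1))
  also have "\<dots> \<le> (\<Prod>i<n. 1 + ((1 + 3 * (1/2 :: real) ^ s) ^ l - 1) / 2 ^ m)"
    by (intro prod_mono conjI 1 integral_nonneg_AE) (auto simp: \<phi>_def)
  finally show "(\<integral>\<omega>. 2 ^ (\<Sum>i<n. participations s l (\<omega> i) - m) \<partial>tapes_space n)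
      \<le> (1 + ((1 + 3 * (1/2 :: real) ^ s) ^ l - 1) / 2 ^ m) ^ n" by simp
  show "integrable (tapes_space n) (\<lambda>\<omega>. 2 ^ (\<Sum>i<n. participations s l (\<omega> i) - m) :: real)"
    unfolding P by (rule E(2))
qed

section \<open>The probability and the number of pairings\<close>

lemma pairing_event:
  "{\<omega> \<in> space (tapes_space n). pairing n (\<lambda>i. device_role s (\<omega> i) t)} \<in> sets (tapes_space n)"
proof -
  interpret prob_space "tapes_space n" by (rule prob_space_tapes_space)
  let ?Y = "\<lambda>k (\<omega> :: nat \<Rightarrow> tape). device_role s (\<omega> (fst k)) (snd k)"
  \<comment> \<open>Over a one-element index set independence is void; what is wanted is the
    measurability that comes with it, all roles of slot \<open>t\<close> forming a single
    block.\<close>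
  have "indep_vars (\<lambda>_. count_space UNIV) (\<lambda>_::unit. \<lambda>\<omega>. pairing n (\<lambda>i. ?Y (i, t) \<omega>)) UNIV"
  proof (rule indep_vars_blocks[OF indep_vars_roles[of n s],
        where K = "\<lambda>_. {..<n} \<times> {t}" and \<phi> = "\<lambda>_ y. pairing n (\<lambda>i. y (i, t))"])
    fix y y' :: "nat \<times> nat \<Rightarrow> role"
    assume "\<And>k. k \<in> {..<n} \<times> {t} \<Longrightarrow> y k = y' k"
    then show "pairing n (\<lambda>i. y (i, t)) = pairing n (\<lambda>i. y' (i, t))"
      by (intro pairing_cong) simp
  qed (auto simp: disjoint_family_on_def)
  then have "(\<lambda>\<omega>. pairing n (\<lambda>i. ?Y (i, t) \<omega>)) \<in> measurable (tapes_space n) (count_space UNIV)"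
    by (simp add: indep_vars_def2)
  from measurable_sets[OF this, of "{True}"] show ?thesis
    by (simp add: vimage_def Int_def conj_commute)
qed

lemma prob_roles_eq:
  assumes "n > 0"
  shows "\<P>(\<omega> in tapes_space n. \<forall>i<n. device_role s (\<omega> i) t = v i)
    = (\<Prod>i<n. \<P>(\<omega> in tapes_space n. device_role s (\<omega> i) t = v i))"
    and "{\<omega> \<in> space (tapes_space n). \<forall>i<n. device_role s (\<omega> i) t = v i} \<in> sets (tapes_space n)"
proof -
  interpret prob_space "tapes_space n" by (rule prob_space_tapes_space)
  let ?Y = "\<lambda>k (\<omega> :: nat \<Rightarrow> tape). device_role s (\<omega> (fst k)) (snd k)"
  let ?S = "\<lambda>i. {\<omega> \<in> space (tapes_space n). device_role s (\<omega> i) t = v i}"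
  have "prob (\<Inter>k\<in>(\<lambda>i. (i, t)) ` {..<n}. ?Y k -` {v (fst k)} \<inter> space (tapes_space n))
      = (\<Prod>k\<in>(\<lambda>i. (i, t)) ` {..<n}. prob (?Y k -` {v (fst k)} \<inter> space (tapes_space n)))"
    using assms by (intro indep_varsD[OF indep_vars_roles[of n s]]) auto
  also have "\<dots> = (\<Prod>i<n. prob (?S i))"
    by (subst prod.reindex) (auto simp: inj_on_def vimage_def Int_def conj_commute)
  also have "(\<Inter>k\<in>(\<lambda>i. (i, t)) ` {..<n}. ?Y k -` {v (fst k)} \<inter> space (tapes_space n))
      = {\<omega> \<in> space (tapes_space n). \<forall>i<n. device_role s (\<omega> i) t = v i}"
    using assms by auto
  finally show "\<P>(\<omega> in tapes_space n. \<forall>i<n. device_role s (\<omega> i) t = v i) = (\<Prod>i<n. prob (?S i))" .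
  have "?S i \<in> events" if "i < n" for i
    using measurable_sets[OF measurable_role[OF that], of "{v i}" s t]
    by (simp add: vimage_def Int_def conj_commute)
  then have "(\<Inter>i\<in>{..<n}. ?S i) \<in> events"
    using assms by (intro sets.finite_INT) auto
  also have "(\<Inter>i\<in>{..<n}. ?S i) = {\<omega> \<in> space (tapes_space n). \<forall>i<n. device_role s (\<omega> i) t = v i}"
    using assms by auto
  finally show "{\<omega> \<in> space (tapes_space n). \<forall>i<n. device_role s (\<omega> i) t = v i} \<in> sets (tapes_space n)" .
qed

text \<open>Each ordered pair of distinct devices contributes the event that the first is the
  sender, the second the replier and all others are absent. These events are disjoint, and
  independence evaluates each of them.\<close>

lemma prob_pairing_ge:
  assumes n: "n \<ge> 2"
  shows "\<P>(\<omega> in tapes_space n. pairing n (\<lambda>i. device_role s (\<omega> i) t))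
    \<ge> real (n * (n - 1)) * ((1/2) ^ Suc s)\<^sup>2 * (1 - (1/2) ^ s) ^ (n - 2)"
proof -
  interpret prob_space "tapes_space n" by (rule prob_space_tapes_space)
  let ?I = "Sigma {..<n} (\<lambda>i. {..<n} - {i})"
  define v where "v k l = (if l = fst k then Sender else if l = snd k then Replier else Absent)"
    for k :: "nat \<times> nat" and l :: nat
  define E where "E k = {\<omega> \<in> space (tapes_space n). \<forall>l<n. device_role s (\<omega> l) t = v k l}" for k
  have Ev: "E k \<in> events" for k
    unfolding E_def using n by (intro prob_roles_eq(2)) simp
  have PE: "prob (E k) = ((1/2) ^ Suc s)\<^sup>2 * (1 - (1/2) ^ s) ^ (n - 2)" if k: "k \<in> ?I" for k
  proof -
    obtain i j where ij: "k = (i, j)" "i < n" "j < n" "i \<noteq> j" using k by auto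
    let ?P = "\<lambda>l. \<P>(\<omega> in tapes_space n. device_role s (\<omega> l) t = v k l)"
    have "prob (E k) = (\<Prod>l<n. ?P l)"
      unfolding E_def using n by (intro prob_roles_eq(1)) simp
    also have "\<dots> = ?P i * (?P j * (\<Prod>l\<in>{..<n} - {i} - {j}. ?P l))"
      using ij by (simp add: prod.remove[of "{..<n}" i] prod.remove[of "{..<n} - {i}" j])
    also have "?P i = (1/2) ^ Suc s" using prob_role(1)[OF ij(2)] ij by (simp add: v_def)
    also have "?P j = (1/2) ^ Suc s" using prob_role(2)[OF ij(3)] ij by (simp add: v_def)
    also have "(\<Prod>l\<in>{..<n} - {i} - {j}. ?P l) = (\<Prod>l\<in>{..<n} - {i} - {j}. 1 - (1/2) ^ s)"
      by (rule prod.cong[OF refl]) (use ij in \<open>simp add: v_def prob_role(4)\<close>)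
    also have "\<dots> = (1 - (1/2) ^ s) ^ (n - 2)"
      using ij by (simp add: card_Diff_singleton_if numeral_2_eq_2)
    finally show ?thesis by (simp add: power2_eq_square)
  qed
  have "(\<Sum>k\<in>?I. prob (E k)) = prob (\<Union>k\<in>?I. E k)"
  proof (rule finite_measure_finite_Union[symmetric])
    show "disjoint_family_on E ?I"
      unfolding disjoint_family_on_def
    proof (intro ballI impI, rule ccontr)
      fix k l assume k: "k \<in> ?I" and l: "l \<in> ?I" and "k \<noteq> l" and "E k \<inter> E l \<noteq> {}"
      then obtain \<omega> where \<omega>: "\<omega> \<in> E k" "\<omega> \<in> E l" by blast
      have eq: "v k i = v l i" if "i < n" for i using \<omega> that by (simp add: E_def)
      have kn: "fst k < n" "snd k < n" "snd k \<noteq> fst k" using k by auto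
      have "v l (fst k) = Sender" using eq[OF kn(1)] by (simp add: v_def)
      then have "fst k = fst l" by (simp add: v_def split: if_splits)
      moreover have "v l (snd k) = Replier" using eq[OF kn(2)] kn(3) by (simp add: v_def)
      then have "snd k = snd l" by (simp add: v_def split: if_splits)
      ultimately show False using \<open>k \<noteq> l\<close> by (simp add: prod_eq_iff)
    qed
  qed (use Ev in auto)
  also have "\<dots> \<le> \<P>(\<omega> in tapes_space n. pairing n (\<lambda>i. device_role s (\<omega> i) t))"
  proof (rule finite_measure_mono[OF _ pairing_event], rule subsetI)
    fix \<omega> assume "\<omega> \<in> (\<Union>k\<in>?I. E k)"
    then obtain i j where ij: "i < n" "j < n" "i \<noteq> j" and \<omega>: "\<omega> \<in> E (i, j)" by auto
    have "pairing n (v (i, j))"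
      unfolding pairing_def v_def using ij by (auto split: if_splits)
    moreover have "pairing n (\<lambda>l. device_role s (\<omega> l) t) = pairing n (v (i, j))"
      using \<omega> by (intro pairing_cong) (simp add: E_def)
    ultimately show "\<omega> \<in> {\<omega> \<in> space (tapes_space n). pairing n (\<lambda>i. device_role s (\<omega> i) t)}"
      using \<omega> by (simp add: E_def)
  qed
  finally have "(\<Sum>k\<in>?I. prob (E k)) \<le> \<P>(\<omega> in tapes_space n. pairing n (\<lambda>i. device_role s (\<omega> i) t))" .
  moreover have "(\<Sum>k\<in>?I. prob (E k)) = real (card ?I) * (((1/2) ^ Suc s)\<^sup>2 * (1 - (1/2) ^ s) ^ (n - 2))"
    using PE by simp
  moreover have "card ?I = n * (n - 1)" by simp
  ultimately show ?thesis by (simp only: mult.assoc)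
qed

lemma prob_pairing_const:
  assumes n: "n \<ge> 2" "n \<le> 2 ^ s" "2 ^ s < 4 * n"
  shows "\<P>(\<omega> in tapes_space n. pairing n (\<lambda>i. device_role s (\<omega> i) t)) \<ge> 1 / 512"
proof -
  obtain s' where s: "s = Suc s'" using n by (cases s) auto
  let ?W = "2 ^ s :: real"
  have W: "real n \<le> ?W" "?W < 4 * real n"
    using n(2,3) by (metis of_nat_le_iff of_nat_numeral of_nat_power)
      (metis n(3) of_nat_less_iff of_nat_mult of_nat_numeral of_nat_power)
  \<comment> \<open>Bernoulli's inequality with exponent \<open>2 ^ s\<close> would only give the
    bound 0; with half that exponent it gives \<open>1/2\<close>, to be squared afterwards.\<close>
  have half: "1/2 \<le> (1 - (1/2) ^ s :: real) ^ (2 ^ s')"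
  proof -
    have "- 1 \<le> - ((1/2) ^ s :: real)" by (simp add: power_le_one)
    from Bernoulli_inequality[OF this, of "2 ^ s'"]
    have "1 - 2 ^ s' * (1/2) ^ s \<le> (1 - (1/2) ^ s :: real) ^ (2 ^ s')" by simp
    moreover have "2 ^ s' * (1/2 :: real) ^ s = 1/2" by (simp add: s power_one_over)
    ultimately show ?thesis by simp
  qed
  have "(1/2) * (1/2) \<le> (1 - (1/2) ^ s :: real) ^ (2 ^ s') * (1 - (1/2) ^ s) ^ (2 ^ s')"
    using half by (intro mult_mono) auto
  also have "\<dots> = (1 - (1/2) ^ s) ^ (2 ^ s)"
    by (simp add: s mult_2 flip: power_add)
  also have "\<dots> \<le> (1 - (1/2) ^ s) ^ (n - 2)"
    using n(2) by (intro power_decreasing) (auto simp: power_le_one)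
  finally have 1: "1/4 \<le> (1 - (1/2) ^ s :: real) ^ (n - 2)" by simp
  have "real n / 2 \<le> real n - 1" using n(1) by simp
  then have nn: "real n * (real n / 2) \<le> real n * (real n - 1)" by (intro mult_left_mono) auto
  have WW: "?W * ?W \<le> (4 * real n) * (4 * real n)" using W by (intro mult_mono) auto
  have 2: "?W\<^sup>2 / 32 \<le> real (n * (n - 1))"
  proof -
    have "real (n * (n - 1)) = real n * (real n - 1)" using n(1) by (simp add: of_nat_diff)
    with nn WW show ?thesis by (simp only: power2_eq_square)
  qed
  \<comment> \<open>The \<open>1/32\<close> combines \<open>n > 2 ^ s / 4\<close>, squared, with
    \<open>n - 1 \<ge> n / 2\<close>. The two chosen roles contribute
    \<open>1 / (4 * ?W\<^sup>2)\<close> and the absence of the others \<open>1/4\<close>.\<close>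
  have "1 / 512 = ?W\<^sup>2 / 32 * ((1/2) ^ Suc s)\<^sup>2 * (1/4)"
    by (simp add: power_one_over field_simps power2_eq_square)
  also have "\<dots> \<le> real (n * (n - 1)) * ((1/2) ^ Suc s)\<^sup>2 * (1 - (1/2) ^ s) ^ (n - 2)"
    using 1 2 by (intro mult_mono) auto
  also have "\<dots> \<le> \<P>(\<omega> in tapes_space n. pairing n (\<lambda>i. device_role s (\<omega> i) t))"
    by (rule prob_pairing_ge[OF n(1)])
  finally show ?thesis .
qed

text \<open>The base is below 1 because the lower tail is wanted; slots are columns of the grid of
  roles, so the expectation factors over them.\<close>

lemma expectation_pairings:
  assumes p: "\<And>t. \<P>(\<omega> in tapes_space n. pairing n (\<lambda>i. device_role s (\<omega> i) t)) \<ge> p"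
  shows "(\<integral>\<omega>. (1/2) ^ card {t. t < l \<and> pairing n (\<lambda>i. device_role s (\<omega> i) t)} \<partial>tapes_space n)
      \<le> (1 - p / 2 :: real) ^ l"
    and "integrable (tapes_space n)
      (\<lambda>\<omega>. (1/2) ^ card {t. t < l \<and> pairing n (\<lambda>i. device_role s (\<omega> i) t)} :: real)"
proof -
  interpret prob_space "tapes_space n" by (rule prob_space_tapes_space)
  define \<phi> :: "nat \<Rightarrow> (nat \<times> nat \<Rightarrow> role) \<Rightarrow> real" where
    "\<phi> t y = (if pairing n (\<lambda>i. y (i, t)) then 1/2 else 1)" for t y
  let ?Y = "\<lambda>k (\<omega> :: nat \<Rightarrow> tape). device_role s (\<omega> (fst k)) (snd k)"
  have K: "\<And>t. t \<in> {..<l} \<Longrightarrow> {..<n} \<times> {t} \<subseteq> {..<n} \<times> UNIV"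
    "\<And>t. t \<in> {..<l} \<Longrightarrow> finite ({..<n} \<times> {t})"
    "disjoint_family_on (\<lambda>t. {..<n} \<times> {t}) {..<l}"
    by (auto simp: disjoint_family_on_def)
  have dep: "\<phi> t y = \<phi> t y'" if "\<And>k. k \<in> {..<n} \<times> {t} \<Longrightarrow> y k = y' k" for t y y'
  proof -
    have "pairing n (\<lambda>i. y (i, t)) = pairing n (\<lambda>i. y' (i, t))"
      by (rule pairing_cong) (use that in auto)
    then show ?thesis by (simp add: \<phi>_def)
  qed
  have bnd: "\<bar>\<phi> t y\<bar> \<le> 1" for t y by (simp add: \<phi>_def)
  note E = expectation_prod_blocks[OF indep_vars_roles[of n s], where L = "{..<l}"
      and K = "\<lambda>t. {..<n} \<times> {t}" and \<phi> = \<phi> and B = 1, OF K dep bnd finite_lessThan]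
  have P: "(1/2) ^ card {t. t < l \<and> pairing n (\<lambda>i. device_role s (\<omega> i) t)}
      = (\<Prod>t<l. \<phi> t (\<lambda>k. ?Y k \<omega>))" for \<omega>
    unfolding power_card_less_eq_prod by (simp add: \<phi>_def)
  have 1: "expectation (\<lambda>\<omega>. \<phi> t (\<lambda>k. ?Y k \<omega>)) \<le> 1 - p / 2" for t
  proof -
    note B = expectation_of_bool[OF pairing_event[of n s t]]
    have "\<phi> t (\<lambda>k. ?Y k \<omega>) = 1 - of_bool (pairing n (\<lambda>i. device_role s (\<omega> i) t)) / 2" for \<omega>
      by (simp add: \<phi>_def)
    then have "expectation (\<lambda>\<omega>. \<phi> t (\<lambda>k. ?Y k \<omega>))
        = 1 - \<P>(\<omega> in tapes_space n. pairing n (\<lambda>i. device_role s (\<omega> i) t)) / 2"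
      using B by (simp add: prob_space)
    then show ?thesis using p[of t] by simp
  qed
  have "(\<integral>\<omega>. (1/2) ^ card {t. t < l \<and> pairing n (\<lambda>i. device_role s (\<omega> i) t)} \<partial>tapes_space n)
      = (\<Prod>t<l. expectation (\<lambda>\<omega>. \<phi> t (\<lambda>k. ?Y k \<omega>)))"
    unfolding P by (rule E(1))
  also have "\<dots> \<le> (\<Prod>t<l. 1 - p / 2)"
    by (intro prod_mono conjI 1 integral_nonneg_AE) (auto simp: \<phi>_def)
  finally show "(\<integral>\<omega>. (1/2) ^ card {t. t < l \<and> pairing n (\<lambda>i. device_role s (\<omega> i) t)} \<partial>tapes_space n)
      \<le> (1 - p / 2 :: real) ^ l" by simp
  show "integrable (tapes_space n)
      (\<lambda>\<omega>. (1/2) ^ card {t. t < l \<and> pairing n (\<lambda>i. device_role s (\<omega> i) t)} :: real)"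
    unfolding P by (rule E(2))
qed

subsection \<open>Tail bounds and the election\<close>

text \<open>The moment of one device may exceed 1 only by a small multiple of its mean activity, so
  that the product over up to \<open>2 ^ s\<close> devices stays exponential in \<open>k\<close>
  however rarely each is active. The inequality \<open>exp y - 1 \<le> y * exp y\<close> supplies
  the factor \<open>y\<close>. The hypothesis on the cap says \<open>m \<ge> 16 + 2 * y\<close>,
  which by \<open>ln 2 \<ge> 1/2\<close> absorbs \<open>exp y\<close> and leaves the divisor
  \<open>2 ^ 16\<close>.\<close>

lemma prob_excess:
  assumes n: "n \<le> 2 ^ s" and m: "16 + 6 * real (32768 * k) * (1/2) ^ s \<le> real m"
  shows "\<P>(\<omega> in tapes_space n. 2 ^ (8 * k) \<le> (2::real) ^ (\<Sum>i<n. participations s (32768 * k) (\<omega> i) - m))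
    \<le> exp (- (5/2) * real k)"
proof -
  interpret prob_space "tapes_space n" by (rule prob_space_tapes_space)
  define l where "l = 32768 * k"
  define y :: real where "y = 3 * (1/2) ^ s * l"
  have y0: "0 \<le> y" by (simp add: y_def)
  note E = expectation_excess[where n = n and s = s and l = l and m = m]
  have "(1 + 3 * (1/2 :: real) ^ s) ^ l \<le> exp (3 * (1/2) ^ s) ^ l"
    by (intro power_mono exp_ge_add_one_self) simp
  also have "\<dots> = exp y" by (simp add: y_def exp_of_nat_mult[symmetric] mult.commute)
  finally have "(1 + 3 * (1/2 :: real) ^ s) ^ l - 1 \<le> exp y - 1" by simp
  also have "exp y - 1 \<le> y * exp y"
    using mult_left_mono[OF exp_ge_add_one_self[of "- y"], of "exp y"]
    by (simp add: exp_minus field_simps)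
  also have "exp y \<le> 2 ^ m / 2 ^ 16"
  proof -
    have m': "2 * y \<le> real m - 16" using m by (simp add: y_def l_def algebra_simps)
    have "y \<le> (real m - 16) * (1/2)" using m' by simp
    also have "\<dots> \<le> (real m - 16) * ln 2"
      using m' y0 ln2_ge_two_thirds by (intro mult_left_mono) auto
    finally have "exp y \<le> 2 powr (real m - 16)" by (simp add: powr_def)
    also have "\<dots> = 2 ^ m / 2 ^ 16" by (simp add: powr_diff powr_realpow)
    finally show ?thesis .
  qed
  finally have "((1 + 3 * (1/2 :: real) ^ s) ^ l - 1) \<le> y * (2 ^ m / 2 ^ 16)"
    using y0 by (simp add: mult_left_mono)
  then have "((1 + 3 * (1/2 :: real) ^ s) ^ l - 1) / 2 ^ m \<le> y / 2 ^ 16"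
    by (simp add: field_simps)
  then have "1 + ((1 + 3 * (1/2 :: real) ^ s) ^ l - 1) / 2 ^ m \<le> exp (y / 2 ^ 16)"
    using exp_ge_add_one_self[of "y / 2 ^ 16"] by linarith
  moreover have "0 \<le> 1 + ((1 + 3 * (1/2 :: real) ^ s) ^ l - 1) / 2 ^ m"
    by (intro add_nonneg_nonneg divide_nonneg_nonneg) simp_all
  ultimately have "(1 + ((1 + 3 * (1/2 :: real) ^ s) ^ l - 1) / 2 ^ m) ^ n \<le> exp (y / 2 ^ 16) ^ n"
    by (rule power_mono)
  also have "\<dots> = exp (n * (y / 2 ^ 16))" by (rule exp_of_nat_mult[symmetric])
  \<comment> \<open>As \<open>n \<le> 2 ^ s\<close>, the product \<open>n * y\<close> is at most
    \<open>3 * 32768 * k\<close>, and dividing by \<open>2 ^ 16\<close> leaves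
    \<open>3/2 * k\<close>. The 16 in the cap is there to bring this below the \<open>4 * k\<close>
    that the threshold \<open>2 ^ (8 * k)\<close> yields.\<close>
  also have "\<dots> \<le> exp (3/2 * real k)"
  proof -
    have "real n \<le> 2 ^ s" using n by (metis of_nat_le_iff of_nat_numeral of_nat_power)
    then have "real n * (1/2) ^ s \<le> 1" by (simp add: power_one_over field_simps)
    then have "real n * (1/2) ^ s * (3 * l / 2 ^ 16) \<le> 1 * (3 * l / 2 ^ 16)"
      by (intro mult_right_mono) auto
    then show ?thesis by (simp add: y_def l_def field_simps)
  qed
  finally have bound: "(1 + ((1 + 3 * (1/2 :: real) ^ s) ^ l - 1) / 2 ^ m) ^ n \<le> exp (3/2 * real k)" .
  have "\<P>(\<omega> in tapes_space n. 2 ^ (8 * k) \<le> (2::real) ^ (\<Sum>i<n. participations s l (\<omega> i) - m))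
      \<le> (\<integral>\<omega>. 2 ^ (\<Sum>i<n. participations s l (\<omega> i) - m) \<partial>tapes_space n) / 2 ^ (8 * k)"
    by (rule integral_Markov_inequality_measure[OF E(2), where A = "{}"]) auto
  also have "\<dots> \<le> exp (3/2 * real k) / 2 ^ (8 * k)"
    using E(1) bound by (intro divide_right_mono) auto
  also have "\<dots> \<le> exp (3/2 * real k) / exp (4 * real k)"
  proof -
    have "exp (4 * real k) \<le> exp (real (8 * k) * ln 2)"
      using mult_left_mono[OF ln2_ge_two_thirds, of "8 * real k"] by simp
    also have "\<dots> = 2 ^ (8 * k)" by (subst powr_realpow[symmetric]) (simp_all add: powr_def)
    finally show ?thesis by (intro divide_left_mono) auto
  qed
  also have "\<dots> = exp (- (5/2) * real k)" by (simp flip: exp_diff)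
  finally show ?thesis by (simp add: l_def)
qed

text \<open>Chernoff's method: with pairing probability at least \<open>1/512\<close> and base
  \<open>1/2\<close>, the moment is at most
  \<open>exp (- 32768 * k / 1024) = exp (- 32 * k)\<close>, and Markov's inequality loses no more
  than \<open>2 ^ (16 * k) \<le> exp (16 * k)\<close>. The event that there are at most
  \<open>16 * k\<close> pairings is written with powers to fit that inequality.\<close>

lemma prob_few_pairings:
  assumes n: "n \<ge> 2" "n \<le> 2 ^ s" "2 ^ s < 4 * n"
  shows "\<P>(\<omega> in tapes_space n. (1/2 :: real) ^ (16 * k)
      \<le> (1/2) ^ card {t. t < 32768 * k \<and> pairing n (\<lambda>i. device_role s (\<omega> i) t)})
    \<le> exp (- 16 * real k)"
proof -
  interpret prob_space "tapes_space n" by (rule prob_space_tapes_space)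
  define l where "l = 32768 * k"
  note E = expectation_pairings[OF prob_pairing_const[OF n], of l]
  have "\<P>(\<omega> in tapes_space n. (1/2 :: real) ^ (16 * k)
      \<le> (1/2) ^ card {t. t < l \<and> pairing n (\<lambda>i. device_role s (\<omega> i) t)})
    \<le> (\<integral>\<omega>. (1/2) ^ card {t. t < l \<and> pairing n (\<lambda>i. device_role s (\<omega> i) t)} \<partial>tapes_space n)
      / (1/2 :: real) ^ (16 * k)"
    by (rule integral_Markov_inequality_measure[OF E(2), where A = "{}"]) auto
  also have "\<dots> \<le> (1 - 1 / 512 / 2) ^ l / (1/2 :: real) ^ (16 * k)"
    using E(1) by (intro divide_right_mono) auto
  also have "\<dots> \<le> exp (- 32 * real k) * exp (16 * real k)"
  proof -
    have "(1 - 1 / 512 / 2 :: real) ^ l \<le> exp (- 1 / 1024) ^ l"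
      using exp_ge_add_one_self[of "- 1 / 1024"] by (intro power_mono) auto
    also have "\<dots> = exp (- 32 * real k)" by (simp add: l_def flip: exp_of_nat_mult)
    finally have 1: "(1 - 1 / 512 / 2 :: real) ^ l \<le> exp (- 32 * real k)" .
    have "(2::real) ^ (16 * k) \<le> exp 1 ^ (16 * k)"
      using exp_ge_add_one_self[of 1] by (intro power_mono) auto
    also have "\<dots> = exp (16 * real k)" by (simp flip: exp_of_nat_mult)
    finally have "1 / (1/2 :: real) ^ (16 * k) \<le> exp (16 * real k)" by (simp add: power_one_over)
    with 1 show ?thesis
      using mult_mono[OF 1, of "1 / (1/2) ^ (16 * k)" "exp (16 * real k)"] by simp
  qed
  also have "\<dots> = exp (- 16 * real k)" by (simp flip: exp_add)
  finally show ?thesis by (simp add: l_def)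
qed

section \<open>The effect of the cap\<close>

lemma capped_cong:
  assumes "\<And>u. u \<le> t \<Longrightarrow> \<rho> u = \<rho>' u"
  shows "capped m \<rho> t = capped m \<rho>' t"
proof -
  have "{u. u < t \<and> \<rho> u \<noteq> Absent} = {u. u < t \<and> \<rho>' u \<noteq> Absent}" using assms by auto
  with assms[of t] show ?thesis by (simp add: capped_def)
qed

lemma card_less_Suc:
  "card {u. u < Suc t \<and> P u} = card {u. u < t \<and> P u} + (if P t then 1 else 0)"
proof (cases "P t")
  case True
  then have "{u. u < Suc t \<and> P u} = insert t {u. u < t \<and> P u}" by (auto simp: less_Suc_eq)
  then show ?thesis using True by simp
next
  case False
  then have "{u. u < Suc t \<and> P u} = {u. u < t \<and> P u}" by (auto simp: less_Suc_eq)
  then show ?thesis using False by simp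
qed

lemma card_capped:
  "card {u. u < t \<and> capped m \<rho> u \<noteq> Absent} = min m (card {u. u < t \<and> \<rho> u \<noteq> Absent})"
  "card {u. u < t \<and> \<rho> u \<noteq> Absent \<and> capped m \<rho> u = Absent} = card {u. u < t \<and> \<rho> u \<noteq> Absent} - m"
proof (induction t)
  case (Suc t)
  {
    case 1
    show ?case using Suc by (simp add: card_less_Suc capped_def[of m \<rho> t])
  next
    case 2
    show ?case using Suc by (simp add: card_less_Suc capped_def[of m \<rho> t] Suc_diff_le)
  }
qed simp_all

text \<open>A pairing can be destroyed only in a slot where some device is suppressed, and one
  suppressed participation affects one slot.\<close>

lemma card_pairing_capped:
  "card {t. t < l \<and> pairing n (\<lambda>i. \<rho> i t)} \<le> card {t. t < l \<and> pairing n (\<lambda>i. capped m (\<rho> i) t)}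
     + (\<Sum>i<n. card {u. u < l \<and> \<rho> i u \<noteq> Absent} - m)"
proof -
  let ?D = "\<lambda>i. {u. u < l \<and> \<rho> i u \<noteq> Absent \<and> capped m (\<rho> i) u = Absent}"
  have "{t. t < l \<and> pairing n (\<lambda>i. \<rho> i t)}
      \<subseteq> {t. t < l \<and> pairing n (\<lambda>i. capped m (\<rho> i) t)} \<union> (\<Union>i<n. ?D i)"
  proof
    fix t assume t: "t \<in> {t. t < l \<and> pairing n (\<lambda>i. \<rho> i t)}"
    show "t \<in> {t. t < l \<and> pairing n (\<lambda>i. capped m (\<rho> i) t)} \<union> (\<Union>i<n. ?D i)"
    proof (cases "\<exists>i<n. t \<in> ?D i")
      case False
      then have "capped m (\<rho> i) t = \<rho> i t" if "i < n" for i
        using t that by (auto simp: capped_def split: if_splits)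
      then have "pairing n (\<lambda>i. capped m (\<rho> i) t) = pairing n (\<lambda>i. \<rho> i t)"
        by (rule pairing_cong)
      then show ?thesis using t by simp
    qed auto
  qed
  then have "card {t. t < l \<and> pairing n (\<lambda>i. \<rho> i t)}
      \<le> card ({t. t < l \<and> pairing n (\<lambda>i. capped m (\<rho> i) t)} \<union> (\<Union>i<n. ?D i))"
    by (intro card_mono) auto
  also have "\<dots> \<le> card {t. t < l \<and> pairing n (\<lambda>i. capped m (\<rho> i) t)} + card (\<Union>i<n. ?D i)"
    by (rule card_Un_le)
  also have "card (\<Union>i<n. ?D i) \<le> (\<Sum>i<n. card (?D i))"
    by (rule card_UN_le) simp
  finally show ?thesis by (simp add: card_capped(2))
qed

section \<open>The algorithm and its runs\<close>

definition election :: "nat \<Rightarrow> nat \<Rightarrow> nat \<Rightarrow> nat \<Rightarrow> algorithm" where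
  "election s m c l = \<lparr>rounds = 4 * l,
     act = (\<lambda>b h. round_action c (capped m (device_role s b)) (nth h) (length h)),
     claims_leader = (\<lambda>b h. l \<in> fst (duty c (capped m (device_role s b)) (nth h) l))\<rparr>"

lemma capped_device_role_cong:
  assumes b: "\<And>j. j < Suc t * Suc s \<Longrightarrow> b j = b' j" and u: "u \<le> t"
  shows "capped m (device_role s b) u = capped m (device_role s b') u"
proof (rule capped_cong)
  fix v assume "v \<le> u"
  then have "v * Suc s \<le> t * Suc s" using u by (intro mult_le_mono1) simp
  then have "b (v * Suc s + j) = b' (v * Suc s + j)" if "j \<le> s" for j
    using that by (intro b) simp
  then show "device_role s b v = device_role s b' v" by (simp add: device_role_def)
qed

lemma randomized_election: "randomized_algorithm (election s m c l)"
  unfolding randomized_algorithm_def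
proof (intro conjI allI)
  fix h :: "nat option list"
  show "(\<lambda>b. act (election s m c l) b h) \<in> measurable tape_space (count_space UNIV)"
  proof (rule measurable_finite_prefix[where l = "Suc (length h) * Suc s"])
    fix b b' :: tape assume *: "\<And>j. j < Suc (length h) * Suc s \<Longrightarrow> b j = b' j"
    have cong: "capped m (device_role s b) u = capped m (device_role s b') u" if "u \<le> length h" for u
      using * that by (rule capped_device_role_cong)
    have "round_action c (capped m (device_role s b)) (nth h) (length h)
        = round_action c (capped m (device_role s b')) (nth h) (length h)"
      by (intro round_action_cong cong) simp_all
    then show "act (election s m c l) b h = act (election s m c l) b' h"
      by (simp add: election_def)
  qed
  show "(\<lambda>b. claims_leader (election s m c l) b h) \<in> measurable tape_space (count_space UNIV)"
  proof (rule measurable_finite_prefix[where l = "Suc l * Suc s"])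
    fix b b' :: tape assume *: "\<And>j. j < Suc l * Suc s \<Longrightarrow> b j = b' j"
    have cong: "capped m (device_role s b) u = capped m (device_role s b') u" if "u \<le> l" for u
      using * that by (rule capped_device_role_cong)
    have "duty c (capped m (device_role s b)) (nth h) l = duty c (capped m (device_role s b')) (nth h) l"
      by (intro duty_cong cong) simp_all
    then show "claims_leader (election s m c l) b h = claims_leader (election s m c l) b' h"
      by (simp add: election_def)
  qed
qed

definition heard :: "algorithm \<Rightarrow> nat \<Rightarrow> (nat \<Rightarrow> tape) \<Rightarrow> nat \<Rightarrow> nat \<Rightarrow> nat option" where
  "heard A n \<omega> i u = no_cd_feedback n (\<lambda>j. act A (\<omega> j) (history A n \<omega> u j)) i"

lemma history_eq_map: "history A n \<omega> t i = map (heard A n \<omega> i) [0..<t]"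
  by (induction t) (simp_all add: heard_def)

context
  fixes s m c l n :: nat and \<omega> :: "nat \<Rightarrow> tape"
begin

abbreviation "alg \<equiv> election s m c l"
abbreviation "roles i \<equiv> capped m (device_role s (\<omega> i))"
abbreviation "ears i \<equiv> heard alg n \<omega> i"

text \<open>A device reads its feedback from a list, whose entries beyond the present are
  unspecified. By causality the complete feedback sequence may be put in its place, which makes
  every run an instance of the fixed-point equation of \<open>chain\<close>.\<close>

lemma act_election: "act alg (\<omega> i) (history alg n \<omega> u i) = round_action c (roles i) (ears i) u"
proof -
  have "act alg (\<omega> i) (history alg n \<omega> u i) = round_action c (roles i) (nth (map (ears i) [0..<u])) u"
    by (simp add: history_eq_map) (simp add: election_def)
  also have "\<dots> = round_action c (roles i) (ears i) u"
    by (rule round_action_cong) simp_all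
  finally show ?thesis .
qed

interpretation chain n c roles ears
  by unfold_locales (simp add: heard_def[of _ _ _ _ _] act_election)

lemma leaders_election: "leaders alg n \<omega> = {i. i < n \<and> l \<in> fst (duty c (roles i) (ears i) l)}"
proof -
  have "duty c (roles i) (nth (map (ears i) [0..<4 * l])) l = duty c (roles i) (ears i) l" for i
    by (rule duty_cong) simp_all
  moreover have "rounds alg = 4 * l" by (simp add: election_def)
  ultimately show ?thesis
    by (simp add: leaders_def history_eq_map) (simp add: election_def)
qed

lemma card_leaders_election: "card (leaders alg n \<omega>) \<le> 1"
proof -
  have "finite (leaders alg n \<omega>)" by (simp add: leaders_def)
  moreover have "\<forall>i\<in>leaders alg n \<omega>. \<forall>j\<in>leaders alg n \<omega>. i = j"
    unfolding leaders_election by (blast intro: unique_duty)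
  ultimately show ?thesis by (simp add: card_le_Suc0_iff_eq)
qed

lemma leaders_election_nonempty:
  assumes "l < c * card {t. t < l \<and> pairing n (\<lambda>i. roles i t)}"
  shows "leaders alg n \<omega> \<noteq> {}"
  using duty_exists[of l] assms unfolding leaders_election by auto

lemma energy_election:
  assumes "i < n"
  shows "energy alg n \<omega> i \<le> 4 * (2 * c + 1) * min m (participations s l (\<omega> i))"
proof -
  have "rounds alg = 4 * l" by (simp add: election_def)
  then show ?thesis
    using energy_bound[OF assms, of l]
    by (simp add: energy_def act_election card_capped(1) participations_def)
qed

end

section \<open>Failure probability and choice of parameters\<close>

lemma prob_no_leader:
  assumes n: "n \<ge> 2" "n \<le> 2 ^ s" "2 ^ s < 4 * n"
    and m: "16 + 6 * real (32768 * k) * (1/2) ^ s \<le> real m" and k: "k > 0"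
  shows "\<P>(\<omega> in tapes_space n. leaders (election s m 4096 (32768 * k)) n \<omega> = {}) \<le> exp (- real k)"
proof -
  interpret prob_space "tapes_space n" by (rule prob_space_tapes_space)
  let ?X = "{\<omega> \<in> space (tapes_space n).
      2 ^ (8 * k) \<le> (2::real) ^ (\<Sum>i<n. participations s (32768 * k) (\<omega> i) - m)}"
  let ?G = "{\<omega> \<in> space (tapes_space n). (1/2 :: real) ^ (16 * k)
      \<le> (1/2) ^ card {t. t < 32768 * k \<and> pairing n (\<lambda>i. device_role s (\<omega> i) t)}}"
  have X: "?X \<in> events"
    by (rule borel_measurable_iff_ge[THEN iffD1, rule_format],
        rule borel_measurable_integrable, rule expectation_excess(2))
  have G: "?G \<in> events"
    by (rule borel_measurable_iff_ge[THEN iffD1, rule_format],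
        rule borel_measurable_integrable, rule expectation_pairings(2)[OF prob_pairing_const[OF n]])
  have "{\<omega> \<in> space (tapes_space n). leaders (election s m 4096 (32768 * k)) n \<omega> = {}} \<subseteq> ?X \<union> ?G"
  proof (rule subsetI, rule ccontr)
    fix \<omega> assume \<omega>: "\<omega> \<in> {\<omega> \<in> space (tapes_space n). leaders (election s m 4096 (32768 * k)) n \<omega> = {}}"
      and "\<omega> \<notin> ?X \<union> ?G"
    then have nX: "\<omega> \<notin> ?X" and nG: "\<omega> \<notin> ?G" and sp: "\<omega> \<in> space (tapes_space n)"
      by (simp_all only: Un_iff de_Morgan_disj mem_Collect_eq simp_thms)
    let ?x = "\<Sum>i<n. participations s (32768 * k) (\<omega> i) - m"
    let ?g = "card {t. t < 32768 * k \<and> pairing n (\<lambda>i. device_role s (\<omega> i) t)}"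
    let ?j = "card {t. t < 32768 * k \<and> pairing n (\<lambda>i. capped m (device_role s (\<omega> i)) t)}"
    have X': "\<not> 2 ^ (8 * k) \<le> (2::real) ^ ?x" and G': "\<not> (1/2 :: real) ^ (16 * k) \<le> (1/2) ^ ?g"
      using nX nG sp by (simp_all only: mem_Collect_eq simp_thms)
    have "?x < 8 * k"
      using X' power_increasing[of "8 * k" ?x "2::real"] by (cases "8 * k \<le> ?x") simp_all
    moreover have "16 * k < ?g"
      using G' power_decreasing[of ?g "16 * k" "1/2 :: real"] by (cases "?g \<le> 16 * k") simp_all
    moreover have "?g \<le> ?j + ?x"
      unfolding participations_def by (rule card_pairing_capped)
    ultimately have "8 * k < ?j" by linarith
    \<comment> \<open>This fixes \<open>c = 32768 / 8\<close>. The inequality is strict because the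
      slot to be owned is the one after the last.\<close>
    then have "32768 * k < 4096 * ?j" by linarith
    then have "leaders (election s m 4096 (32768 * k)) n \<omega> \<noteq> {}"
      by (rule leaders_election_nonempty)
    with \<omega> show False by (simp only: mem_Collect_eq simp_thms)
  qed
  then have "\<P>(\<omega> in tapes_space n. leaders (election s m 4096 (32768 * k)) n \<omega> = {}) \<le> prob (?X \<union> ?G)"
    by (rule finite_measure_mono) (rule sets.Un[OF X G])
  also have "\<dots> \<le> prob ?X + prob ?G" by (rule measure_Un_le[OF X G])
  also have "\<dots> \<le> exp (- (5/2) * real k) + exp (- 16 * real k)"
    by (intro add_mono prob_excess prob_few_pairings n m)
  also have "\<dots> \<le> 2 * exp (- (5/2) * real k)" by simp
  \<comment> \<open>The factor 2 of the union bound is paid out of the exponent, which is possible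
    because \<open>k \<ge> 1\<close>.\<close>
  also have "\<dots> \<le> exp (3/2 * real k) * exp (- (5/2) * real k)"
  proof (rule mult_right_mono)
    show "2 \<le> exp (3/2 * real k)"
      using exp_ge_add_one_self[of "3/2 * real k"] k by linarith
  qed simp
  also have "\<dots> = exp (- real k)" by (simp flip: exp_add)
  finally show ?thesis .
qed

theorem theorem3p3:
  "\<exists>C::real. C > 0 \<and>
     (\<forall>(f::real) (N::nat). 0 < f \<and> f < 1 \<and> N \<ge> 2 \<longrightarrow>
       (\<exists>A. randomized_algorithm A \<and>
          real (rounds A) \<le> C * log_inv f \<and>
          (\<forall>n. (\<forall>i<n. (\<integral>\<omega>. real (energy A n \<omega> i) \<partial>tapes_space n) \<le> C * (log_inv f / real N)) \<and>
               (\<forall>\<omega>. \<forall>i<n. real (energy A n \<omega> i) \<le> C * (1 + log 2 (1 / f) / real N)) \<and>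
               (\<forall>\<omega>. card (leaders A n \<omega>) \<le> 1) \<and>
               (real N / 2 < real n \<and> n \<le> N \<longrightarrow>
                  \<P>(\<omega> in tapes_space n. leaders A n \<omega> = {}) \<le> f))))"
proof (intro exI[of _ "32772 * 393233 :: real"] conjI allI impI; (elim conjE)?)
  \<comment> \<open>The constant is \<open>32772 = 4 * (2 * 4096 + 1)\<close>, the energy per
    participation, times \<open>393233 = 17 + 6 * 65536\<close>, which comes from the bound on the
    cap \<open>m\<close>.\<close>
  fix f :: real and N :: nat
  assume f: "0 < f" "f < 1" and N: "N \<ge> 2"
  define k where "k = nat \<lceil>log_inv f\<rceil>"
  define l where "l = 32768 * k"
  obtain s where s: "N \<le> 2 ^ s" "2 ^ s < 2 * N"
  proof -
    obtain a where "2 ^ a < N" "N \<le> 2 ^ (a + 1)" using ex_power_ivl2[of 2 N] N by auto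
    then show thesis by (intro that[of "a + 1"]) auto
  qed
  \<comment> \<open>The cap is six times the mean number of participations
    \<open>l * (1/2) ^ s\<close>, plus the slack 16 that keeps the total excess small.\<close>
  define m where "m = 16 + nat \<lceil>6 * real l * (1/2) ^ s\<rceil>"
  let ?A = "election s m 4096 l"
  have log0: "0 < log 2 (1 / f)" using f by simp
  have li: "1 \<le> log_inv f" "log 2 (1 / f) \<le> log_inv f" "log_inv f \<le> 1 + log 2 (1 / f)"
    using log0 by (auto simp: log_inv_def)
  have k: "log_inv f \<le> real k" "real k \<le> 2 * log_inv f" "k > 0"
    using li(1) unfolding k_def by linarith+
  have l: "real l \<le> 65536 * log_inv f" using k(2) by (simp add: l_def)
  have s': "real N \<le> 2 ^ s" using s(1) by (metis of_nat_le_iff of_nat_numeral of_nat_power)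
  have q: "real l * (1/2) ^ s \<le> 65536 * (log_inv f / N)"
  proof -
    have "(1/2 :: real) ^ s \<le> 1 / N" using s' N by (simp add: power_one_over field_simps)
    then have "real l * (1/2) ^ s \<le> 65536 * log_inv f * (1 / N)"
      using l by (intro mult_mono) auto
    then show ?thesis by simp
  qed
  have "0 \<le> 6 * real l * (1/2) ^ s" by simp
  then have m: "16 + 6 * real l * (1/2) ^ s \<le> real m" "real m \<le> 17 + 6 * (real l * (1/2) ^ s)"
    unfolding m_def by linarith+
  show "\<exists>A. randomized_algorithm A \<and>
          real (rounds A) \<le> 32772 * 393233 * log_inv f \<and>
          (\<forall>n. (\<forall>i<n. (\<integral>\<omega>. real (energy A n \<omega> i) \<partial>tapes_space n) \<le> 32772 * 393233 * (log_inv f / real N)) \<and>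
               (\<forall>\<omega>. \<forall>i<n. real (energy A n \<omega> i) \<le> 32772 * 393233 * (1 + log 2 (1 / f) / real N)) \<and>
               (\<forall>\<omega>. card (leaders A n \<omega>) \<le> 1) \<and>
               (real N / 2 < real n \<and> n \<le> N \<longrightarrow>
                  \<P>(\<omega> in tapes_space n. leaders A n \<omega> = {}) \<le> f))"
  proof (intro exI[of _ ?A] conjI allI impI; (elim conjE)?)
    show "randomized_algorithm ?A" by (rule randomized_election)
    have "real (rounds ?A) = 4 * real l" by (simp add: election_def)
    then show "real (rounds ?A) \<le> 32772 * 393233 * log_inv f" using l li(1) by linarith
  next
    fix n i :: nat assume i: "i < n"
    \<comment> \<open>The mean number of participations of one device depends only on its own tape,
      so the bound holds for every \<open>n\<close>, also outside the range between
      \<open>N / 2\<close> and \<open>N\<close>.\<close>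
    note P = expectation_participations[OF i, of s l]
    have "(\<integral>\<omega>. real (energy ?A n \<omega> i) \<partial>tapes_space n)
        \<le> (\<integral>\<omega>. 32772 * real (participations s l (\<omega> i)) \<partial>tapes_space n)"
    proof (rule integral_mono')
      show "integrable (tapes_space n) (\<lambda>\<omega>. 32772 * real (participations s l (\<omega> i)))"
        using P(2) by simp
      fix \<omega>
      show "real (energy ?A n \<omega> i) \<le> 32772 * real (participations s l (\<omega> i))"
        using energy_election[OF i, of s m 4096 l \<omega>] by simp
    qed simp
    also have "\<dots> = 32772 * (real l * (1/2) ^ s)" using P by simp
    also have "\<dots> \<le> 32772 * (65536 * (log_inv f / N))" using q by simp
    also have "\<dots> \<le> 32772 * 393233 * (log_inv f / N)"
    proof -
      have "32772 * (65536 * x) \<le> 32772 * 393233 * x" if "0 \<le> x" for x :: real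
        using that by simp
      moreover have "0 \<le> log_inv f / real N" using li(1) by simp
      ultimately show ?thesis .
    qed
    finally show "(\<integral>\<omega>. real (energy ?A n \<omega> i) \<partial>tapes_space n) \<le> 32772 * 393233 * (log_inv f / N)" .
  next
    fix n i :: nat and \<omega> assume i: "i < n"
    have "real (energy ?A n \<omega> i) \<le> 32772 * real m"
      using energy_election[OF i, of s m 4096 l \<omega>] by simp
    also have "\<dots> \<le> 32772 * (17 + 6 * (65536 * (log_inv f / N)))"
      using m(2) q by simp
    \<comment> \<open>The worst-case bound is stated with the true logarithm;
      \<open>log_inv f\<close> exceeds it by at most 1, and the resulting \<open>1 / N\<close> goes
      into the additive constant.\<close>
    also have "\<dots> \<le> 32772 * (17 + 6 * (65536 * (1 + log 2 (1 / f) / N)))"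
    proof -
      have "log_inv f / N \<le> (1 + log 2 (1 / f)) / N" using li(3) by (intro divide_right_mono) auto
      also have "\<dots> = 1 / N + log 2 (1 / f) / N" by (simp add: add_divide_distrib)
      also have "1 / real N \<le> 1" using N by simp
      finally show ?thesis by simp
    qed
    also have "\<dots> \<le> 32772 * 393233 * (1 + log 2 (1 / f) / N)"
    proof -
      have "32772 * (17 + 6 * (65536 * (1 + x))) \<le> 32772 * 393233 * (1 + x)" if "0 \<le> x" for x :: real
        using that by simp
      moreover have "0 \<le> log 2 (1 / f) / real N" using log0 by simp
      ultimately show ?thesis .
    qed
    finally show "real (energy ?A n \<omega> i) \<le> 32772 * 393233 * (1 + log 2 (1 / f) / N)" .
  next
    fix n :: nat and \<omega> show "card (leaders ?A n \<omega>) \<le> 1" by (rule card_leaders_election)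
  next
    fix n :: nat assume n: "real N / 2 < real n" "n \<le> N"
    have "N < 2 * n" using n(1) by linarith
    then have n': "n \<ge> 2" "n \<le> 2 ^ s" "2 ^ s < 4 * n" using N n(2) s by linarith+
    have "\<P>(\<omega> in tapes_space n. leaders ?A n \<omega> = {}) \<le> exp (- real k)"
      unfolding l_def by (rule prob_no_leader[OF n']) (use m(1) k(3) in \<open>simp_all add: l_def\<close>)
    also have "\<dots> \<le> exp (ln f)"
    proof -
      have "ln (1 / f) = log 2 (1 / f) * ln 2" by (simp add: log_def)
      also have "\<dots> \<le> log 2 (1 / f) * 1" using log0 ln_2_less_1 by (intro mult_left_mono) auto
      also have "\<dots> \<le> real k" using li(2) k(1) by linarith
      finally have "ln (1 / f) \<le> real k" .
      then have "- real k \<le> ln f" using f(1) by (simp add: ln_div)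
      then show ?thesis by (simp only: exp_le_cancel_iff)
    qed
    also have "\<dots> = f" using f by simp
    finally show "\<P>(\<omega> in tapes_space n. leaders ?A n \<omega> = {}) \<le> f" .
  qed
qed simp

end
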